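(* Let $C=\langle t\rangle$ be an infinite cyclic group and let $M=\mathbb{Z}^2$ be the $\mathbb{Z}[C]$-module on which $t$ acts by the matrix $\begin{pmatrix}-1&1\\0&-1\end{pmatrix}$. Then the $H\mathbb{Z}$-length of the group $$G:=M\rtimes C=\langle a,b,t\mid [a,b]=1,\ a^t=a^{-1},\ b^t=ab^{-1}\rangle$$ is greater than $\omega+1$.
   Context: Homology is with integral coefficients. An $H\mathbb{Z}$-map is a group homomorphism inducing an isomorphism on $H_1$ and an epimorphism on $H_2$. A group $\Gamma$ is $H\mathbb{Z}$-local if every $H\mathbb{Z}$-map $G\to H$ induces a bijection $\mathrm{Hom}(H,\Gamma)\to\mathrm{Hom}(G,\Gamma)$. The $H\mathbb{Z}$-localization $\eta:G\to EG$ of a group $G$ is the (unique up to isomorphism) $H\mathbb{Z}$-map with $EG$ an $H\mathbb{Z}$-local group; it exists for every $G$ (Bousfield). The transfinite lower central series is $\gamma_1(G)=G$, $\gamma_{\tau+1}(G)=[\gamma_\tau(G),G]$, $\gamma_\alpha(G)=\bigcap_{\tau<\alpha}\gamma_\tau(G)$ for limit ordinals $\alpha$. $H\mathbb{Z}\text{-length}(G)$ is the least ordinal $\tau$ with $\gamma_\tau(EG)=1$ (it exists since $EG$ is transfinitely nilpotent). Notation: $a^t$ is the conjugate of $a$ by $t$. The matrix acts on column vectors, i.e. with the standard basis $e_1,e_2$ of $\mathbb{Z}^2$ (corresponding to $a,b$), $t$ sends $e_1\mapsto -e_1$ and $e_2\mapsto e_1-e_2$. *)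

theory Defs
  imports
    "HOL-Algebra.Free_Abelian_Groups"
    "HOL-Algebra.Generated_Groups"
    "HOL-Analysis.Cartesian_Space"
begin

section \<open>Integral homology of groups via the bar complex\<close>

text \<open>
  The \<open>n\<close>-chains are the free abelian group on the bar symbols \<open>[g\<^sub>1|\<dots>|g\<^sub>n]\<close>, that is, on the
  lists of length \<open>n\<close> over the carrier. This is the unnormalized bar resolution tensored with the
  trivial module of integers.
\<close>

definition bar_symbols :: "nat \<Rightarrow> ('a, 'b) monoid_scheme \<Rightarrow> 'a list set" where
  "bar_symbols n G = {xs. length xs = n \<and> set xs \<subseteq> carrier G}"

definition bar_chain_group :: "nat \<Rightarrow> ('a, 'b) monoid_scheme \<Rightarrow> ('a list \<Rightarrow>\<^sub>0 int) monoid" where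
  "bar_chain_group n G = free_Abelian_group (bar_symbols n G)"

text \<open>
  Face \<open>i\<close> drops the first entry (\<open>i = 0\<close>), drops the last entry (\<open>i = n\<close>), or multiplies the
  neighbours \<open>g\<^sub>i\<close> and \<open>g\<^bsub>i+1\<^esub>\<close>, which sit at the list positions \<open>i - 1\<close> and \<open>i\<close>.
\<close>

definition bar_face :: "('a, 'b) monoid_scheme \<Rightarrow> nat \<Rightarrow> 'a list \<Rightarrow> 'a list" where
  "bar_face G i xs =
     (if i = 0 then tl xs
      else if i = length xs then butlast xs
      else take (i - 1) xs @ [xs ! (i - 1) \<otimes>\<^bsub>G\<^esub> xs ! i] @ drop (i + 1) xs)"

definition bar_boundary ::
  "('a, 'b) monoid_scheme \<Rightarrow> ('a list \<Rightarrow>\<^sub>0 int) \<Rightarrow> ('a list \<Rightarrow>\<^sub>0 int)" where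
  "bar_boundary G =
     frag_extend (\<lambda>xs. if xs = [] then 0
                       else \<Sum>i\<le>length xs. frag_cmul ((-1) ^ i) (frag_of (bar_face G i xs)))"

definition bar_cycles :: "nat \<Rightarrow> ('a, 'b) monoid_scheme \<Rightarrow> ('a list \<Rightarrow>\<^sub>0 int) set" where
  "bar_cycles n G = {c \<in> carrier (bar_chain_group n G). bar_boundary G c = 0}"

definition bar_boundaries :: "nat \<Rightarrow> ('a, 'b) monoid_scheme \<Rightarrow> ('a list \<Rightarrow>\<^sub>0 int) set" where
  "bar_boundaries n G = bar_boundary G ` carrier (bar_chain_group (Suc n) G)"

definition bar_cycle_group :: "nat \<Rightarrow> ('a, 'b) monoid_scheme \<Rightarrow> ('a list \<Rightarrow>\<^sub>0 int) monoid" where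
  "bar_cycle_group n G = subgroup_generated (bar_chain_group n G) (bar_cycles n G)"

definition group_homology ::
  "nat \<Rightarrow> ('a, 'b) monoid_scheme \<Rightarrow> ('a list \<Rightarrow>\<^sub>0 int) set monoid" where
  "group_homology n G = bar_cycle_group n G Mod bar_boundaries n G"

definition bar_chain_map :: "('a \<Rightarrow> 'c) \<Rightarrow> ('a list \<Rightarrow>\<^sub>0 int) \<Rightarrow> ('c list \<Rightarrow>\<^sub>0 int)" where
  "bar_chain_map f = frag_extend (\<lambda>xs. frag_of (map f xs))"

text \<open>
  A homology class is a coset of the boundaries. Its image is the coset of the chain-level image,
  obtained by adding all boundaries of the target.
\<close>

definition group_homology_map ::
  "nat \<Rightarrow> ('c, 'd) monoid_scheme \<Rightarrow> ('a \<Rightarrow> 'c) \<Rightarrow>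
     ('a list \<Rightarrow>\<^sub>0 int) set \<Rightarrow> ('c list \<Rightarrow>\<^sub>0 int) set" where
  "group_homology_map n H f A =
     bar_boundaries n H <#>\<^bsub>bar_cycle_group n H\<^esub> (bar_chain_map f ` A)"


section \<open>\<open>H\<int>\<close>-maps, \<open>H\<int>\<close>-local groups and \<open>H\<int>\<close>-localization\<close>

definition HZ_map ::
  "('a, 'b) monoid_scheme \<Rightarrow> ('c, 'd) monoid_scheme \<Rightarrow> ('a \<Rightarrow> 'c) \<Rightarrow> bool" where
  "HZ_map G H f \<longleftrightarrow>
     group G \<and> group H \<and> f \<in> hom G H \<and>
     group_homology_map 1 H f \<in> iso (group_homology 1 G) (group_homology 1 H) \<and>
     group_homology_map 2 H f \<in> epi (group_homology 2 G) (group_homology 2 H)"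

text \<open>
  Homomorphisms are normalized to be \<open>undefined\<close> outside the carrier, so that distinct elements of
  \<open>Hom G H\<close> are distinct as homomorphisms.
\<close>

definition Hom :: "('a, 'b) monoid_scheme \<Rightarrow> ('c, 'd) monoid_scheme \<Rightarrow> ('a \<Rightarrow> 'c) set" where
  "Hom G H = hom G H \<inter> extensional (carrier G)"

text \<open>
  HOL cannot quantify over all types inside a definition, so the class of test maps is that of all
  \<open>H\<int>\<close>-maps between groups carried by subsets of a type \<open>'u\<close>. For infinite \<open>'u\<close> the notion does
  not depend on \<open>'u\<close>: every \<open>H\<int>\<close>-map is an \<open>\<aleph>\<^sub>1\<close>-directed union of \<open>H\<int>\<close>-maps between countable
  subgroups (homology commutes with directed unions, and a countable pair of subgroups can be
  closed up in countably many steps so that the conditions on the first and second homology hold),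
  so it suffices to test \<open>H\<int>\<close>-maps between countable groups.
\<close>

definition HZ_local :: "'u itself \<Rightarrow> ('g, 'h) monoid_scheme \<Rightarrow> bool" where
  "HZ_local U \<Gamma> \<longleftrightarrow>
     group \<Gamma> \<and>
     (\<forall>(G :: 'u monoid) (H :: 'u monoid) f. HZ_map G H f \<longrightarrow>
        bij_betw (\<lambda>\<phi>. compose (carrier G) \<phi> f) (Hom H \<Gamma>) (Hom G \<Gamma>))"

definition HZ_localization ::
  "'u itself \<Rightarrow> ('a, 'b) monoid_scheme \<Rightarrow> ('c, 'd) monoid_scheme \<Rightarrow> ('a \<Rightarrow> 'c) \<Rightarrow> bool" where
  "HZ_localization U G E \<eta> \<longleftrightarrow> HZ_map G E \<eta> \<and> HZ_local U E"


section \<open>The transfinite lower central series\<close>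

definition commutator_subgroup :: "('a, 'b) monoid_scheme \<Rightarrow> 'a set \<Rightarrow> 'a set \<Rightarrow> 'a set" where
  "commutator_subgroup G A B =
     generate G {a \<otimes>\<^bsub>G\<^esub> b \<otimes>\<^bsub>G\<^esub> inv\<^bsub>G\<^esub> a \<otimes>\<^bsub>G\<^esub> inv\<^bsub>G\<^esub> b | a b. a \<in> A \<and> b \<in> B}"

text \<open>
  Ordinals are well-orders \<open>r\<close>, compared by \<open><o\<close>; the ordinals below \<open>r\<close> are its initial segments
  \<open>initial_seg r i\<close>. The series starts at the ordinal \<open>1\<close>; the value at the ordinal \<open>0\<close> and at
  relations that are not well-orders is a dummy.
\<close>

definition initial_seg :: "'o rel \<Rightarrow> 'o \<Rightarrow> 'o rel" where
  "initial_seg r i = Restr r (underS r i)"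

definition is_last :: "'o rel \<Rightarrow> 'o \<Rightarrow> bool" where
  "is_last r m \<longleftrightarrow> m \<in> Field r \<and> (\<forall>i\<in>Field r. (i, m) \<in> r)"

function lower_central :: "('a, 'b) monoid_scheme \<Rightarrow> 'o rel \<Rightarrow> 'a set" where
  "lower_central G r =
     (if \<not> Well_order r \<or> (\<exists>x. Field r \<subseteq> {x}) then carrier G
      else if \<exists>m. is_last r m
        then commutator_subgroup G (lower_central G (initial_seg r (THE m. is_last r m))) (carrier G)
      else \<Inter>i\<in>Field r. lower_central G (initial_seg r i))"
  by auto
termination
proof (relation "inv_image ordLess snd")
  show "wf (inv_image (ordLess :: ('o rel \<times> 'o rel) set) (snd :: ('a, 'b) monoid_scheme \<times> 'o rel \<Rightarrow> _))"
    by (intro wf_inv_image wf_ordLess)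
next
  fix G :: "('a, 'b) monoid_scheme" and r :: "'o rel"
  assume w: "\<not> (\<not> Well_order r \<or> (\<exists>x. Field r \<subseteq> {x}))" and ex: "\<exists>m. is_last r m"
  then obtain m where m: "is_last r m" by blast
  have "antisym r"
    using w by (simp add: order_on_defs)
  then have "(THE m. is_last r m) = m"
    using m by (intro the_equality) (auto simp: is_last_def antisym_def)
  then show "((G, initial_seg r (THE m. is_last r m)), (G, r)) \<in> inv_image ordLess snd"
    using w m by (auto simp: initial_seg_def is_last_def intro!: underS_Restr_ordLess)
next
  fix G :: "('a, 'b) monoid_scheme" and r :: "'o rel" and i
  assume "\<not> (\<not> Well_order r \<or> (\<exists>x. Field r \<subseteq> {x}))" "i \<in> Field r"
  then show "((G, initial_seg r i), (G, r)) \<in> inv_image ordLess snd"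
    by (auto simp: initial_seg_def intro!: underS_Restr_ordLess)
qed

declare lower_central.simps [simp del]

text \<open>The well-order \<open>r\<close> represents the least ordinal (at least \<open>1\<close>) at which the series is trivial.\<close>

definition is_lower_central_length :: "('a, 'b) monoid_scheme \<Rightarrow> 'o rel \<Rightarrow> bool" where
  "is_lower_central_length G r \<longleftrightarrow>
     Well_order r \<and> Field r \<noteq> {} \<and> lower_central G r = {\<one>\<^bsub>G\<^esub>} \<and>
     (\<forall>s :: 'o rel. s <o r \<and> Field s \<noteq> {} \<longrightarrow> lower_central G s \<noteq> {\<one>\<^bsub>G\<^esub>})"

text \<open>
  The ordinal \<open>r\<close> is the \<open>H\<int>\<close>-length of \<open>G\<close>, computed from a localization carried by the type
  \<open>'e\<close>. Locality is tested on groups carried by subsets of the larger type \<open>'e set\<close>, which in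
  particular contains a copy of every quotient of the localization.
\<close>

definition is_HZ_length :: "'e itself \<Rightarrow> ('a, 'b) monoid_scheme \<Rightarrow> 'o rel \<Rightarrow> bool" where
  "is_HZ_length T G r \<longleftrightarrow>
     (\<exists>(E :: 'e monoid) \<eta>. HZ_localization TYPE('e set) G E \<eta> \<and> is_lower_central_length E r)"

definition ord_succ :: "'o rel \<Rightarrow> 'o option rel" where
  "ord_succ r = {(Some x, Some y) | x y. (x, y) \<in> r} \<union> {(x, None) | x. x \<in> Some ` Field r \<union> {None}}"

abbreviation omega_plus_one :: "nat option rel" where
  "omega_plus_one \<equiv> ord_succ natLeq"


section \<open>The group \<open>\<int>\<^sup>2 \<rtimes> C\<close>\<close>

definition int_funpow :: "('m \<Rightarrow> 'm) \<Rightarrow> int \<Rightarrow> 'm \<Rightarrow> 'm" where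
  "int_funpow \<theta> k = (if 0 \<le> k then \<theta> ^^ nat k else inv_into UNIV \<theta> ^^ nat (- k))"

text \<open>
  The semidirect product of an additive group with the infinite cyclic group of integers, whose
  generator \<open>t = (0, 1)\<close> acts through the automorphism \<open>\<theta>\<close>: in it, \<open>t m t\<inverse> = \<theta> m\<close>.
\<close>

definition semidirect_cyclic :: "('m::ab_group_add \<Rightarrow> 'm) \<Rightarrow> ('m \<times> int) monoid" where
  "semidirect_cyclic \<theta> =
     \<lparr>carrier = UNIV,
      monoid.mult = (\<lambda>(m, i) (n, j). (m + int_funpow \<theta> i n, i + j)),
      one = (0, 0)\<rparr>"

definition action_matrix :: "int ^ 2 ^ 2" where
  "action_matrix = vector [vector [-1, 1], vector [0, -1]]"

text \<open>
  Matrices are given by their rows and act on column vectors. With \<open>a = (e\<^sub>1, 0)\<close>, \<open>b = (e\<^sub>2, 0)\<close>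
  and \<open>t = (0, 1)\<close> one has \<open>t a t\<inverse> = a\<inverse>\<close> and \<open>t b t\<inverse> = a b\<inverse>\<close>. The opposite convention
  for conjugation gives an isomorphic group, via \<open>t \<mapsto> t\<inverse>\<close>.
\<close>

definition MC :: "((int ^ 2) \<times> int) monoid" where
  "MC = semidirect_cyclic (\<lambda>v. action_matrix *v v)"

end

theory Submission
  imports
    Defs
    "HOL-Algebra.Weak_Morphisms"
    "HOL-Library.Z2"
begin

text \<open>
  Let \<open>\<eta> : G \<rightarrow> E\<close> be an \<open>H\<int>\<close>-localization of \<open>G = M \<rtimes> C\<close>, with generators \<open>a\<close>, \<open>b\<close> of \<open>M\<close> and
  \<open>t\<close> of \<open>C\<close>, and write \<open>[x, y] = x y x\<inverse> y\<inverse>\<close>. The proof exhibits a nontrivial element of the term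
  of \<open>E\<close> with index \<open>\<omega> + 1\<close>. It is \<open>[[x, b], t]\<close>, where \<open>x \<in> E\<close> is a "2-adic power" of \<open>b\<close>, whose
  exponent is the irrational root \<open>\<theta> = 1 + 2\<theta>\<^sup>2\<close> in the ring of 2-adic integers.

  Why \<open>x\<close> exists. On \<open>M\<close> modulo \<open>a\<close> the element \<open>t\<close> acts as \<open>-1\<close>, so that \<open>[x, t]\<close> is twice \<open>x\<close> in
  additive notation, and \<open>\<theta> = \<Sum> c\<^sub>j 2\<^sup>j\<close> is obtained by solving the infinite system
  \<open>x\<^sub>j = b\<^bsup>c\<^sub>j\<^esup> [x\<^bsub>j+1\<^esub>, t]\<close>. In a local group such systems have solutions
  (\<open>HZ_local_solve_tower\<close>): the map of free groups that sends the generator \<open>x\<^sub>j\<close> to the \<open>j\<close>-th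
  equation is an isomorphism on \<open>H\<^sub>1\<close>, because the unknowns on the right only occur in commutators,
  and \<open>H\<^sub>2\<close> of a free group vanishes; hence it is an \<open>H\<int>\<close>-map, and locality extends over it.

  Why \<open>[x, b]\<close> lies in the term with index \<open>\<omega>\<close>. The system shows that \<open>x\<close> agrees with an element of
  the abelian group \<open>\<eta>(M)\<close> modulo each term whose index is finite (\<open>tower_commutator_in_lcs\<close>). Therefore
  \<open>[[x, b], t]\<close> lies in the next term.

  Why \<open>[[x, b], t] \<noteq> 1\<close>. Only the fact that \<open>\<eta>\<close> is an \<open>H\<int>\<close>-map is used here, in the form that a
  2-cocycle of \<open>E\<close> which is a coboundary on \<open>G\<close> is a coboundary on \<open>E\<close>
  (\<open>HZ_map_trivializes_cocycle\<close>). Applied once for every power of \<open>2\<close>, it extends the coordinates of \<open>G\<close>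
  to functions on \<open>E\<close>: a homomorphism \<open>k\<close> to the integers, and a crossed homomorphism to the 2-adic
  completion of \<open>M\<close>, with \<open>a\<close>-coordinate \<open>p\<close> and \<open>b\<close>-coordinate \<open>q\<close>. Choose additive maps \<open>\<mu>\<close>,
  \<open>\<nu>\<close> from the 2-adic integers to the rationals that are dual to the independent elements \<open>1\<close> and
  \<open>\<theta>\<close>. The crossed homomorphisms \<open>\<mu>q\<close> and \<open>\<nu>q\<close> have a cup product that vanishes on \<open>G\<close>, since \<open>\<nu>q\<close>
  does. So it is the coboundary of a function \<open>f\<close> on \<open>E\<close>, and \<open>f [x, b] = -1\<close> because
  \<open>\<mu>q\<close> and \<open>\<nu>q\<close> take the values \<open>0, 1\<close> at \<open>x\<close> and \<open>1, 0\<close> at \<open>b\<close>. As the action of \<open>t\<close> on \<open>M\<close> is not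
  diagonalizable, also the product of \<open>k\<close> with \<open>\<mu>q\<close> is a coboundary, namely of \<open>\<mu>p\<close> up to sign, and
  the Massey product of \<open>k\<close>, \<open>\<mu>q\<close> and \<open>\<nu>q\<close> is defined; it vanishes on \<open>G\<close>, hence on \<open>E\<close>, and a
  function that bounds it takes the value \<open>- f [x, b]\<close> at \<open>[[x, b], t]\<close>.
\<close>

section \<open>The bar complex in low degrees\<close>

lemma bar_boundary_add: "bar_boundary G (x + y) = bar_boundary G x + bar_boundary G y"
  by (simp add: bar_boundary_def frag_extend_add)

lemma bar_boundary_diff: "bar_boundary G (x - y) = bar_boundary G x - bar_boundary G y"
  by (simp add: bar_boundary_def frag_extend_diff)

lemma bar_boundary_0 [simp]: "bar_boundary G 0 = 0"
  by (simp add: bar_boundary_def)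

lemma bar_boundary_symbol1: "bar_boundary G (frag_of [a]) = 0"
  by (simp add: bar_boundary_def bar_face_def)

lemma bar_boundary_symbol2:
  "bar_boundary G (frag_of [a, b]) = frag_of [b] - frag_of [a \<otimes>\<^bsub>G\<^esub> b] + frag_of [a]"
  by (simp add: bar_boundary_def bar_face_def eval_nat_numeral atMost_Suc)

lemma bar_boundary_symbol3:
  "bar_boundary G (frag_of [a, b, c]) =
     frag_of [b, c] - frag_of [a \<otimes>\<^bsub>G\<^esub> b, c] + frag_of [a, b \<otimes>\<^bsub>G\<^esub> c] - frag_of [a, b]"
  by (simp add: bar_boundary_def bar_face_def eval_nat_numeral atMost_Suc)

lemma bar_chain_map_add: "bar_chain_map f (x + y) = bar_chain_map f x + bar_chain_map f y"
  by (simp add: bar_chain_map_def frag_extend_add)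

lemma bar_chain_map_diff: "bar_chain_map f (x - y) = bar_chain_map f x - bar_chain_map f y"
  by (simp add: bar_chain_map_def frag_extend_diff)

lemma bar_chain_map_0 [simp]: "bar_chain_map f 0 = 0"
  by (simp add: bar_chain_map_def)

lemma bar_chain_map_of [simp]: "bar_chain_map f (frag_of xs) = frag_of (map f xs)"
  by (simp add: bar_chain_map_def)

definition bar_chains :: "nat \<Rightarrow> ('a, 'b) monoid_scheme \<Rightarrow> ('a list \<Rightarrow>\<^sub>0 int) set" where
  "bar_chains n G = {c. Poly_Mapping.keys c \<subseteq> bar_symbols n G}"

lemma carrier_bar_chain_group: "carrier (bar_chain_group n G) = bar_chains n G"
  by (auto simp: bar_chain_group_def bar_chains_def)

lemma bar_chains_0 [simp]: "0 \<in> bar_chains n G"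
  by (simp add: bar_chains_def)

lemma bar_chains_diff: "x \<in> bar_chains n G \<Longrightarrow> y \<in> bar_chains n G \<Longrightarrow> x - y \<in> bar_chains n G"
  unfolding bar_chains_def using keys_diff[of x y] by auto

lemma bar_chains_add: "x \<in> bar_chains n G \<Longrightarrow> y \<in> bar_chains n G \<Longrightarrow> x + y \<in> bar_chains n G"
  unfolding bar_chains_def using keys_add[of x y] by auto

lemma frag_of_bar_chains [simp]: "frag_of xs \<in> bar_chains n G \<longleftrightarrow> length xs = n \<and> set xs \<subseteq> carrier G"
  by (simp add: bar_chains_def bar_symbols_def)

lemma bar_chains_induct [consumes 1, case_names zero one diff]:
  assumes "c \<in> bar_chains n G" "P 0"
    "\<And>xs. length xs = n \<Longrightarrow> set xs \<subseteq> carrier G \<Longrightarrow> P (frag_of xs)"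
    "\<And>a b. P a \<Longrightarrow> P b \<Longrightarrow> P (a - b)"
  shows "P c"
  using assms(1) unfolding bar_chains_def
  by (intro frag_induction[where P = P and S = "bar_symbols n G" and c = c])
     (use assms(2-) in \<open>auto simp: bar_symbols_def\<close>)

lemma bar_chain_map_chains:
  assumes "f \<in> carrier G \<rightarrow> carrier H" "c \<in> bar_chains n G"
  shows "bar_chain_map f c \<in> bar_chains n H"
  using assms(2)
  by (induction rule: bar_chains_induct)
     (use assms(1) in \<open>auto simp: bar_chain_map_diff intro!: bar_chains_diff\<close>)

lemma bar_face_map:
  assumes "f \<in> hom G H" "set xs \<subseteq> carrier G" "xs \<noteq> []" "i \<le> length xs"
  shows "bar_face H i (map f xs) = map f (bar_face G i xs)"
proof -
  have "f (xs ! (i - 1) \<otimes>\<^bsub>G\<^esub> xs ! i) = f (xs ! (i - 1)) \<otimes>\<^bsub>H\<^esub> f (xs ! i)" if "i < length xs"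
    using that assms(2) nth_mem[of "i - 1" xs] nth_mem[of i xs]
    by (intro hom_mult[OF assms(1)]) auto
  then show ?thesis
    using assms by (auto simp: bar_face_def map_tl map_butlast take_map drop_map)
qed

lemma bar_chain_map_sum: "bar_chain_map f (sum g I) = (\<Sum>i\<in>I. bar_chain_map f (g i))"
  by (induction I rule: infinite_finite_induct) (auto simp: bar_chain_map_add)

lemma bar_chain_map_cmul: "bar_chain_map f (frag_cmul k x) = frag_cmul k (bar_chain_map f x)"
  by (simp add: bar_chain_map_def frag_extend_cmul)

lemma bar_boundary_chain_map:
  assumes "f \<in> hom G H" "c \<in> bar_chains n G"
  shows "bar_boundary H (bar_chain_map f c) = bar_chain_map f (bar_boundary G c)"
  using assms(2)
proof (induction rule: bar_chains_induct)
  case (one xs)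
  then show ?case
    by (simp add: bar_boundary_def bar_chain_map_sum bar_chain_map_cmul bar_face_map[OF assms(1)])
qed (simp_all add: bar_boundary_diff bar_chain_map_diff)

lemma length1_conv: "length xs = Suc 0 \<longleftrightarrow> (\<exists>a. xs = [a])"
  by (auto simp: length_Suc_conv)

lemma length2_conv: "length xs = 2 \<longleftrightarrow> (\<exists>a b. xs = [a, b])"
  by (auto simp: length_Suc_conv eval_nat_numeral)

lemma length3_conv: "length xs = 3 \<longleftrightarrow> (\<exists>a b c. xs = [a, b, c])"
  by (auto simp: length_Suc_conv eval_nat_numeral)

lemma bar_cycles_eq: "bar_cycles n G = {c \<in> bar_chains n G. bar_boundary G c = 0}"
  by (simp add: bar_cycles_def carrier_bar_chain_group)

lemma bar_boundaries_eq: "bar_boundaries n G = bar_boundary G ` bar_chains (Suc n) G"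
  by (simp add: bar_boundaries_def carrier_bar_chain_group)

lemma bar_boundaries_0 [simp]: "0 \<in> bar_boundaries n G"
  unfolding bar_boundaries_eq by (rule image_eqI[of _ _ 0]) auto

lemma bar_boundaries_diff:
  "x \<in> bar_boundaries n G \<Longrightarrow> y \<in> bar_boundaries n G \<Longrightarrow> x - y \<in> bar_boundaries n G"
  unfolding bar_boundaries_eq by (auto simp flip: bar_boundary_diff intro!: imageI bar_chains_diff)

lemma bar_boundaries_add:
  "x \<in> bar_boundaries n G \<Longrightarrow> y \<in> bar_boundaries n G \<Longrightarrow> x + y \<in> bar_boundaries n G"
  unfolding bar_boundaries_eq by (auto simp flip: bar_boundary_add intro!: imageI bar_chains_add)

lemma bar_cycles_1: "bar_cycles 1 G = bar_chains 1 G"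
proof -
  have "bar_boundary G c = 0" if "c \<in> bar_chains 1 G" for c
    using that
    by (induction rule: bar_chains_induct)
       (auto simp: bar_boundary_diff bar_boundary_symbol1 length1_conv)
  then show ?thesis by (auto simp: bar_cycles_eq)
qed

lemma bar_boundaries_map:
  assumes "f \<in> hom G H" "c \<in> bar_boundaries n G"
  shows "bar_chain_map f c \<in> bar_boundaries n H"
  using assms bar_boundary_chain_map[OF assms(1), symmetric]
    bar_chain_map_chains[of f G H] by (auto simp: bar_boundaries_eq hom_def)

lemma bar_cycles_map:
  assumes "f \<in> hom G H" "c \<in> bar_cycles n G"
  shows "bar_chain_map f c \<in> bar_cycles n H"
  using assms bar_boundary_chain_map[OF assms(1)]
    bar_chain_map_chains[of f G H] by (auto simp: bar_cycles_eq hom_def)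

lemma carrier_bar_cycle_group: "carrier (bar_cycle_group n G) = bar_cycles n G"
proof -
  have "subgroup (bar_cycles n G) (bar_chain_group n G)"
    unfolding bar_chain_group_def
    by (rule group.group_incl_imp_subgroup[OF group_free_Abelian_group] group.subgroupI[OF group_free_Abelian_group])+
       (auto simp: bar_cycles_eq bar_chains_def bar_boundary_add bar_boundary_diff[of _ 0, simplified]
         dest!: subsetD[OF keys_add])
  then show ?thesis
    unfolding bar_cycle_group_def by (rule subgroup.carrier_subgroup_generated_subgroup)
qed

section \<open>Homology isomorphisms and epimorphisms in terms of cycles\<close>

lemma mult_bar_cycle_group [simp]: "monoid.mult (bar_cycle_group n G) = (+)"
  by (simp add: bar_cycle_group_def bar_chain_group_def fun_eq_iff)

lemma bar_cycles_diff: "x \<in> bar_cycles n G \<Longrightarrow> y \<in> bar_cycles n G \<Longrightarrow> x - y \<in> bar_cycles n G"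
  by (simp add: bar_cycles_eq bar_chains_diff bar_boundary_diff)

definition bar_class :: "nat \<Rightarrow> ('a, 'b) monoid_scheme \<Rightarrow> ('a list \<Rightarrow>\<^sub>0 int) \<Rightarrow> ('a list \<Rightarrow>\<^sub>0 int) set" where
  "bar_class n G x = (\<lambda>b. b + x) ` bar_boundaries n G"

lemma carrier_group_homology: "carrier (group_homology n G) = bar_class n G ` bar_cycles n G"
  unfolding group_homology_def carrier_FactGroup carrier_bar_cycle_group
  by (auto simp: r_coset_def bar_class_def)

lemma bar_class_eq_iff: "bar_class n G x = bar_class n G y \<longleftrightarrow> x - y \<in> bar_boundaries n G"
proof
  assume "bar_class n G x = bar_class n G y"
  moreover have "x \<in> bar_class n G x"
    unfolding bar_class_def by (rule image_eqI[of _ _ 0]) auto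
  ultimately show "x - y \<in> bar_boundaries n G"
    by (auto simp: bar_class_def)
next
  assume *: "x - y \<in> bar_boundaries n G"
  show "bar_class n G x = bar_class n G y"
  proof (intro Set.set_eqI iffI)
    fix z assume "z \<in> bar_class n G x"
    then obtain b where b: "b \<in> bar_boundaries n G" "z = b + x" by (auto simp: bar_class_def)
    then have "z = (b + (x - y)) + y" by simp
    then show "z \<in> bar_class n G y"
      unfolding bar_class_def using bar_boundaries_add[OF b(1) *] by blast
  next
    fix z assume "z \<in> bar_class n G y"
    then obtain b where b: "b \<in> bar_boundaries n G" "z = b + y" by (auto simp: bar_class_def)
    then have "z = (b - (x - y)) + x" by simp
    then show "z \<in> bar_class n G x"
      unfolding bar_class_def using bar_boundaries_diff[OF b(1) *] by blast
  qed
qed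

lemma mult_group_homology:
  "bar_class n G x \<otimes>\<^bsub>group_homology n G\<^esub> bar_class n G y = bar_class n G (x + y)"
proof -
  have "bar_class n G x \<otimes>\<^bsub>group_homology n G\<^esub> bar_class n G y
      = {(b + x) + (b' + y) | b b'. b \<in> bar_boundaries n G \<and> b' \<in> bar_boundaries n G}"
    by (auto simp: group_homology_def set_mult_def bar_class_def)
  also have "\<dots> = bar_class n G (x + y)"
  proof (intro Set.set_eqI iffI)
    fix z assume "z \<in> {(b + x) + (b' + y) | b b'. b \<in> bar_boundaries n G \<and> b' \<in> bar_boundaries n G}"
    then obtain b b' where "b \<in> bar_boundaries n G" "b' \<in> bar_boundaries n G" "z = (b + b') + (x + y)"
      by (auto simp: algebra_simps)
    then show "z \<in> bar_class n G (x + y)"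
      unfolding bar_class_def using bar_boundaries_add by blast
  next
    fix z assume "z \<in> bar_class n G (x + y)"
    then obtain b where b: "b \<in> bar_boundaries n G" "z = b + (x + y)" by (auto simp: bar_class_def)
    then have "z = (b + x) + (0 + y)" by simp
    then show "z \<in> {(b + x) + (b' + y) | b b'. b \<in> bar_boundaries n G \<and> b' \<in> bar_boundaries n G}"
      using b(1) bar_boundaries_0 by blast
  qed
  finally show ?thesis .
qed

lemma group_homology_map_class:
  assumes "f \<in> hom G H"
  shows "group_homology_map n H f (bar_class n G x) = bar_class n H (bar_chain_map f x)"
proof -
  have "group_homology_map n H f (bar_class n G x)
      = {b + (bar_chain_map f b' + bar_chain_map f x) | b b'. b \<in> bar_boundaries n H \<and> b' \<in> bar_boundaries n G}"
    by (auto simp: group_homology_map_def set_mult_def bar_class_def bar_chain_map_add)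
  also have "\<dots> = bar_class n H (bar_chain_map f x)"
  proof (intro Set.set_eqI iffI)
    fix z assume "z \<in> {b + (bar_chain_map f b' + bar_chain_map f x) | b b'. b \<in> bar_boundaries n H \<and> b' \<in> bar_boundaries n G}"
    then obtain b b' where b: "b \<in> bar_boundaries n H" "b' \<in> bar_boundaries n G"
      "z = (b + bar_chain_map f b') + bar_chain_map f x"
      by (auto simp: algebra_simps)
    then show "z \<in> bar_class n H (bar_chain_map f x)"
      unfolding bar_class_def using bar_boundaries_add[OF b(1) bar_boundaries_map[OF assms b(2)]] by blast
  next
    fix z assume "z \<in> bar_class n H (bar_chain_map f x)"
    then obtain b where b: "b \<in> bar_boundaries n H" "z = b + bar_chain_map f x" by (auto simp: bar_class_def)
    then have "z = b + (bar_chain_map f 0 + bar_chain_map f x)" by simp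
    then show "z \<in> {b + (bar_chain_map f b' + bar_chain_map f x) | b b'. b \<in> bar_boundaries n H \<and> b' \<in> bar_boundaries n G}"
      using b(1) bar_boundaries_0 by blast
  qed
  finally show ?thesis .
qed

lemma group_homology_map_hom:
  assumes "f \<in> hom G H"
  shows "group_homology_map n H f \<in> hom (group_homology n G) (group_homology n H)"
  using bar_cycles_map[OF assms]
  by (auto simp: hom_def carrier_group_homology group_homology_map_class[OF assms]
      mult_group_homology bar_chain_map_add)

text \<open>
  The two halves of an isomorphism on homology, spelled out for representing chains. In this form
  they can be combined with chain-level computations without mentioning cosets.
\<close>

definition homology_inj :: "nat \<Rightarrow> ('a, 'b) monoid_scheme \<Rightarrow> ('c, 'd) monoid_scheme \<Rightarrow> ('a \<Rightarrow> 'c) \<Rightarrow> bool" where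
  "homology_inj n G H f \<longleftrightarrow>
     (\<forall>x \<in> bar_cycles n G. bar_chain_map f x \<in> bar_boundaries n H \<longrightarrow> x \<in> bar_boundaries n G)"

definition homology_surj :: "nat \<Rightarrow> ('a, 'b) monoid_scheme \<Rightarrow> ('c, 'd) monoid_scheme \<Rightarrow> ('a \<Rightarrow> 'c) \<Rightarrow> bool" where
  "homology_surj n G H f \<longleftrightarrow>
     (\<forall>y \<in> bar_cycles n H. \<exists>x \<in> bar_cycles n G. y - bar_chain_map f x \<in> bar_boundaries n H)"

lemma homology_surj_iff:
  assumes "f \<in> hom G H"
  shows "homology_surj n G H f \<longleftrightarrow>
    group_homology_map n H f ` carrier (group_homology n G) = carrier (group_homology n H)"
proof -
  have im: "group_homology_map n H f ` carrier (group_homology n G) =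
      (\<lambda>x. bar_class n H (bar_chain_map f x)) ` bar_cycles n G"
    by (simp add: carrier_group_homology group_homology_map_class[OF assms] image_image)
  have "homology_surj n G H f \<longleftrightarrow>
      (\<forall>y \<in> bar_cycles n H. bar_class n H y \<in> (\<lambda>x. bar_class n H (bar_chain_map f x)) ` bar_cycles n G)"
    unfolding homology_surj_def image_iff bar_class_eq_iff ..
  also have "\<dots> \<longleftrightarrow> carrier (group_homology n H) \<subseteq> (\<lambda>x. bar_class n H (bar_chain_map f x)) ` bar_cycles n G"
    by (simp only: carrier_group_homology image_subset_iff)
  also have "\<dots> \<longleftrightarrow> (\<lambda>x. bar_class n H (bar_chain_map f x)) ` bar_cycles n G = carrier (group_homology n H)"
    using bar_cycles_map[OF assms] by (auto simp only: carrier_group_homology)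
  finally show ?thesis unfolding im .
qed

lemma homology_inj_iff:
  assumes "f \<in> hom G H"
  shows "homology_inj n G H f \<longleftrightarrow> inj_on (group_homology_map n H f) (carrier (group_homology n G))"
proof
  assume "homology_inj n G H f"
  then show "inj_on (group_homology_map n H f) (carrier (group_homology n G))"
    by (auto simp: inj_on_def carrier_group_homology group_homology_map_class[OF assms]
        bar_class_eq_iff homology_inj_def bar_cycles_diff simp flip: bar_chain_map_diff)
next
  assume inj: "inj_on (group_homology_map n H f) (carrier (group_homology n G))"
  have "x \<in> bar_boundaries n G"
    if "x \<in> bar_cycles n G" "bar_chain_map f x \<in> bar_boundaries n H" for x
  proof -
    have "0 \<in> bar_cycles n G" by (simp add: bar_cycles_eq)
    moreover have "group_homology_map n H f (bar_class n G x) = group_homology_map n H f (bar_class n G 0)"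
      using that by (simp add: group_homology_map_class[OF assms] bar_class_eq_iff)
    ultimately have "bar_class n G x = bar_class n G 0"
      using inj that(1) by (auto simp: inj_on_def carrier_group_homology)
    then show ?thesis by (simp add: bar_class_eq_iff)
  qed
  then show "homology_inj n G H f" by (simp add: homology_inj_def)
qed

lemma HZ_map_iff:
  "HZ_map G H f \<longleftrightarrow> group G \<and> group H \<and> f \<in> hom G H \<and>
     homology_inj 1 G H f \<and> homology_surj 1 G H f \<and> homology_surj 2 G H f"
proof (cases "f \<in> hom G H")
  case True
  then show ?thesis
    using group_homology_map_hom[OF True] homology_inj_iff[OF True] homology_surj_iff[OF True]
    by (simp add: HZ_map_def iso_def epi_def bij_betw_def)
qed (simp add: HZ_map_def)

lemma bar_chain_map_compose: "bar_chain_map (g \<circ> f) c = bar_chain_map g (bar_chain_map f c)"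
  using subset_UNIV
  by (induction c rule: frag_induction) (simp_all add: bar_chain_map_diff comp_def)

lemma bar_chain_map_cong:
  assumes "c \<in> bar_chains n G" "\<And>x. x \<in> carrier G \<Longrightarrow> f x = g x"
  shows "bar_chain_map f c = bar_chain_map g c"
  using assms(1)
proof (induction rule: bar_chains_induct)
  case (one xs)
  then have "map f xs = map g xs" using assms(2) by auto
  then show ?case by (simp only: bar_chain_map_of)
qed (simp_all add: bar_chain_map_diff)

lemma HZ_map_compose:
  assumes f: "HZ_map G H f" and g: "HZ_map H K g"
  shows "HZ_map G K (g \<circ> f)"
proof -
  have hf: "f \<in> hom G H" and hg: "g \<in> hom H K" and "group G" "group K" "group H"
    using f g by (simp_all add: HZ_map_iff)
  have surj: "homology_surj n G K (g \<circ> f)" if s1: "homology_surj n G H f" and s2: "homology_surj n H K g" for n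
    unfolding homology_surj_def
  proof
    fix z assume "z \<in> bar_cycles n K"
    then obtain y where y: "y \<in> bar_cycles n H" "z - bar_chain_map g y \<in> bar_boundaries n K"
      using s2 by (auto simp: homology_surj_def)
    then obtain x where x: "x \<in> bar_cycles n G" "y - bar_chain_map f x \<in> bar_boundaries n H"
      using s1 by (auto simp: homology_surj_def)
    have "(z - bar_chain_map g y) + bar_chain_map g (y - bar_chain_map f x) \<in> bar_boundaries n K"
      using y(2) bar_boundaries_map[OF hg x(2)] by (rule bar_boundaries_add)
    then show "\<exists>x\<in>bar_cycles n G. z - bar_chain_map (g \<circ> f) x \<in> bar_boundaries n K"
      using x(1) by (auto simp: bar_chain_map_diff bar_chain_map_compose)
  qed
  have "homology_inj 1 G K (g \<circ> f)"
    using f g bar_cycles_map[OF hf]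
    by (auto simp: HZ_map_iff homology_inj_def bar_chain_map_compose)
  then show ?thesis
    using f g surj hom_compose[OF hf hg] by (simp add: HZ_map_iff)
qed

lemma HZ_map_iso:
  assumes "group G" "group H" "f \<in> iso G H"
  shows "HZ_map G H f"
proof -
  define h where "h = inv_into (carrier G) f"
  have hf: "f \<in> hom G H" using assms by (simp add: iso_def)
  have hh: "h \<in> hom H G"
    using group.iso_set_sym[OF assms(1,3)] by (simp add: h_def iso_def)
  have fh: "f (h y) = y" if "y \<in> carrier H" for y
    using assms(3) that by (simp add: h_def iso_def bij_betw_def f_inv_into_f)
  have hfx: "h (f x) = x" if "x \<in> carrier G" for x
    using assms(3) that by (simp add: h_def iso_def bij_betw_def)
  have id: "bar_chain_map (\<lambda>x. x) c = c" for c :: "'x list \<Rightarrow>\<^sub>0 int"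
    unfolding bar_chain_map_def list.map_ident by (rule frag_expansion[symmetric])
  have 1: "bar_chain_map f (bar_chain_map h y) = y" if "y \<in> bar_chains n H" for n y
    using bar_chain_map_cong[OF that, of "f \<circ> h" "\<lambda>x. x"] fh by (simp add: bar_chain_map_compose id)
  have 2: "bar_chain_map h (bar_chain_map f y) = y" if "y \<in> bar_chains n G" for n y
    using bar_chain_map_cong[OF that, of "h \<circ> f" "\<lambda>x. x"] hfx by (simp add: bar_chain_map_compose id)
  have "homology_inj n G H f" for n
    unfolding homology_inj_def
  proof (intro ballI impI)
    fix x assume "x \<in> bar_cycles n G" "bar_chain_map f x \<in> bar_boundaries n H"
    then show "x \<in> bar_boundaries n G"
      using bar_boundaries_map[OF hh, of "bar_chain_map f x"] 2[of x n] by (simp add: bar_cycles_eq)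
  qed
  moreover have "homology_surj n G H f" for n
    unfolding homology_surj_def
  proof
    fix y assume "y \<in> bar_cycles n H"
    then show "\<exists>x\<in>bar_cycles n G. y - bar_chain_map f x \<in> bar_boundaries n H"
      using 1[of y n] bar_cycles_map[OF hh, of y n] by (intro bexI[of _ "bar_chain_map h y"]) (simp_all add: bar_cycles_eq)
  qed
  ultimately show ?thesis using assms hf by (simp add: HZ_map_iff)
qed

section \<open>Cocycles along \<open>H\<int>\<close>-maps\<close>

text \<open>
  The linear extension of a cochain \<open>\<phi>\<close> to chains. The values used below are integers, rationals and
  elements of the field with two elements; their ring structure only serves to multiply by the
  integer coefficients of a chain.
\<close>

definition frag_eval :: "('k \<Rightarrow> 'v::comm_ring_1) \<Rightarrow> ('k \<Rightarrow>\<^sub>0 int) \<Rightarrow> 'v" where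
  "frag_eval \<phi> x = (\<Sum>k\<in>Poly_Mapping.keys x. of_int (Poly_Mapping.lookup x k) * \<phi> k)"

lemma frag_eval_superset:
  assumes "finite K" "Poly_Mapping.keys x \<subseteq> K"
  shows "frag_eval \<phi> x = (\<Sum>k\<in>K. of_int (Poly_Mapping.lookup x k) * \<phi> k)"
  unfolding frag_eval_def
  by (rule sum.mono_neutral_left) (use assms in \<open>auto simp: in_keys_iff\<close>)

lemma frag_eval_diff: "frag_eval \<phi> (x - y) = frag_eval \<phi> x - frag_eval \<phi> y"
proof -
  let ?K = "Poly_Mapping.keys x \<union> Poly_Mapping.keys y"
  have "frag_eval \<phi> (x - y) = (\<Sum>k\<in>?K. of_int (Poly_Mapping.lookup (x - y) k) * \<phi> k)"
    by (rule frag_eval_superset) (simp_all add: keys_diff)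
  also have "\<dots> = (\<Sum>k\<in>?K. of_int (Poly_Mapping.lookup x k) * \<phi> k) - (\<Sum>k\<in>?K. of_int (Poly_Mapping.lookup y k) * \<phi> k)"
    by (simp add: lookup_minus algebra_simps sum_subtractf)
  finally show ?thesis
    by (simp add: frag_eval_superset[of ?K])
qed

lemma frag_eval_0 [simp]: "frag_eval \<phi> 0 = 0"
  by (simp add: frag_eval_def)

lemma frag_eval_add: "frag_eval \<phi> (x + y) = frag_eval \<phi> x + frag_eval \<phi> y"
  using frag_eval_diff[of \<phi> x "0 - y"] frag_eval_diff[of \<phi> 0 y] by simp

lemma frag_eval_of [simp]: "frag_eval \<phi> (frag_of k) = \<phi> k"
  by (simp add: frag_eval_def)

text \<open>
  In terms of cohomology: \<open>H\<^sup>2(E; V) \<rightarrow> H\<^sup>2(G; V)\<close> is injective, and a cochain on \<open>G\<close> that bounds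
  the restricted cocycle extends to \<open>E\<close>. Since \<open>\<eta>\<close> is onto on \<open>H\<^sub>1\<close>, each \<open>[g]\<close> is \<open>\<eta> x + \<partial> z\<close> for a
  1-chain \<open>x\<close> of \<open>G\<close> and a 2-chain \<open>z\<close> of \<open>E\<close>, which forces the value \<open>d g = e x + c z\<close>. It does not
  depend on \<open>x\<close> and \<open>z\<close>: injectivity on \<open>H\<^sub>1\<close> reduces this to 2-cycles, and surjectivity on \<open>H\<^sub>2\<close>
  to boundaries and to 2-cycles of \<open>G\<close>, where \<open>c\<close> vanishes.
\<close>

proposition HZ_map_trivializes_cocycle:
  fixes c :: "'c \<Rightarrow> 'c \<Rightarrow> 'v::comm_ring_1" and e :: "'a \<Rightarrow> 'v"
  assumes HZ: "HZ_map G E \<eta>"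
    and cocycle: "\<And>g h l. \<lbrakk>g \<in> carrier E; h \<in> carrier E; l \<in> carrier E\<rbrakk> \<Longrightarrow>
        c g h + c (g \<otimes>\<^bsub>E\<^esub> h) l = c h l + c g (h \<otimes>\<^bsub>E\<^esub> l)"
    and e: "\<And>g h. \<lbrakk>g \<in> carrier G; h \<in> carrier G\<rbrakk> \<Longrightarrow>
        c (\<eta> g) (\<eta> h) = e g + e h - e (g \<otimes>\<^bsub>G\<^esub> h)"
  obtains d where
    "\<And>g h. \<lbrakk>g \<in> carrier E; h \<in> carrier E\<rbrakk> \<Longrightarrow> c g h = d g + d h - d (g \<otimes>\<^bsub>E\<^esub> h)"
    "\<And>g. g \<in> carrier G \<Longrightarrow> d (\<eta> g) = e g"
proof -
  interpret G: group G using HZ by (simp add: HZ_map_iff)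
  interpret E: group E using HZ by (simp add: HZ_map_iff)
  have \<eta>: "\<eta> \<in> hom G E" using HZ by (simp add: HZ_map_iff)
  define C where "C = frag_eval (\<lambda>xs. c (xs ! 0) (xs ! 1))"
  define e1 where "e1 = frag_eval (\<lambda>xs. e (xs ! 0))"
  have C_boundary: "C (bar_boundary E w) = 0" if "w \<in> bar_chains 3 E" for w
    using that
  proof (induction rule: bar_chains_induct)
    case (one xs)
    then show ?case
      using cocycle
      by (auto simp: length3_conv bar_boundary_symbol3 C_def frag_eval_add frag_eval_diff algebra_simps)
  qed (simp_all add: C_def bar_boundary_diff frag_eval_diff)
  have C_\<eta>: "C (bar_chain_map \<eta> z) = e1 (bar_boundary G z)" if "z \<in> bar_chains 2 G" for z
    using that
  proof (induction rule: bar_chains_induct)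
    case (one xs)
    then show ?case
      using e
      by (auto simp: length2_conv bar_boundary_symbol2 C_def e1_def frag_eval_add frag_eval_diff algebra_simps)
  qed (simp_all add: C_def e1_def bar_boundary_diff bar_chain_map_diff frag_eval_diff)
  \<comment> \<open>the well-definedness of \<open>d\<close> below\<close>
  have key: "e1 x + C z = 0"
    if x: "x \<in> bar_chains 1 G" and z: "z \<in> bar_chains 2 E"
      and 0: "bar_chain_map \<eta> x + bar_boundary E z = 0" for x z
  proof -
    have "bar_chain_map \<eta> x = bar_boundary E (0 - z)"
      using 0 by (simp add: bar_boundary_diff[of E 0 z, simplified] eq_neg_iff_add_eq_0)
    then have "bar_chain_map \<eta> x \<in> bar_boundaries 1 E"
      unfolding bar_boundaries_eq using bar_chains_diff[OF bar_chains_0 z] by (auto simp: eval_nat_numeral)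
    then have "x \<in> bar_boundaries 1 G"
      using HZ x bar_cycles_1 by (auto simp: HZ_map_iff homology_inj_def)
    then obtain z' where z': "z' \<in> bar_chains 2 G" "x = bar_boundary G z'"
      by (auto simp: bar_boundaries_eq eval_nat_numeral)
    have "bar_chain_map \<eta> z' + z \<in> bar_cycles 2 E"
      using 0 z z' bar_chain_map_chains[of \<eta> G E z' 2] \<eta> bar_boundary_chain_map[OF \<eta> z'(1)]
      by (auto simp: bar_cycles_eq hom_def bar_boundary_add intro: bar_chains_add)
    then obtain z'' where z'': "z'' \<in> bar_cycles 2 G"
      "bar_chain_map \<eta> z' + z - bar_chain_map \<eta> z'' \<in> bar_boundaries 2 E"
      using HZ by (auto simp: HZ_map_iff homology_surj_def)
    then have "C (bar_chain_map \<eta> z' + z - bar_chain_map \<eta> z'') = 0"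
      using C_boundary by (auto simp: bar_boundaries_eq eval_nat_numeral)
    moreover have "C (bar_chain_map \<eta> z'') = 0"
      using z''(1) C_\<eta>[of z''] by (simp add: bar_cycles_eq e1_def)
    ultimately show ?thesis
      using C_\<eta>[OF z'(1)] z'(2) by (simp add: C_def frag_eval_add frag_eval_diff)
  qed
  have "\<exists>x z. x \<in> bar_chains 1 G \<and> z \<in> bar_chains 2 E \<and>
      frag_of [g] = bar_chain_map \<eta> x + bar_boundary E z" if "g \<in> carrier E" for g
  proof -
    have "frag_of [g] \<in> bar_cycles 1 E" using that unfolding bar_cycles_1 by simp
    then obtain x where x: "x \<in> bar_cycles 1 G" "frag_of [g] - bar_chain_map \<eta> x \<in> bar_boundaries 1 E"
      using HZ by (auto simp: HZ_map_iff homology_surj_def)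
    then obtain z where "z \<in> bar_chains 2 E" "frag_of [g] - bar_chain_map \<eta> x = bar_boundary E z"
      by (auto simp: bar_boundaries_eq eval_nat_numeral)
    then show ?thesis using x(1) unfolding bar_cycles_1 by (auto simp: algebra_simps)
  qed
  then obtain X Z where XZ: "\<And>g. g \<in> carrier E \<Longrightarrow> X g \<in> bar_chains 1 G"
    "\<And>g. g \<in> carrier E \<Longrightarrow> Z g \<in> bar_chains 2 E"
    "\<And>g. g \<in> carrier E \<Longrightarrow> frag_of [g] = bar_chain_map \<eta> (X g) + bar_boundary E (Z g)"
    by metis
  define d where "d g = e1 (X g) + C (Z g)" for g
  have "c g h = d g + d h - d (g \<otimes>\<^bsub>E\<^esub> h)" if g: "g \<in> carrier E" and h: "h \<in> carrier E" for g h
  proof -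
    let ?k = "g \<otimes>\<^bsub>E\<^esub> h"
    have k: "?k \<in> carrier E" using g h by simp
    have "e1 (X g + X h - X ?k) + C (Z g + Z h - Z ?k - frag_of [g, h]) = 0"
    proof (rule key)
      show "bar_chain_map \<eta> (X g + X h - X ?k) + bar_boundary E (Z g + Z h - Z ?k - frag_of [g, h]) = 0"
        using XZ(3)[OF g] XZ(3)[OF h] XZ(3)[OF k]
        by (simp add: bar_chain_map_add bar_chain_map_diff bar_boundary_add bar_boundary_diff
            bar_boundary_symbol2 algebra_simps)
    qed (use XZ g h k in \<open>auto intro!: bar_chains_add bar_chains_diff\<close>)
    moreover have "C (frag_of [g, h]) = c g h" by (simp add: C_def)
    ultimately show ?thesis
      by (simp add: d_def C_def e1_def frag_eval_add frag_eval_diff algebra_simps)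
  qed
  moreover have "d (\<eta> g) = e g" if g: "g \<in> carrier G" for g
  proof -
    have k: "\<eta> g \<in> carrier E" using \<eta> g by (auto simp: hom_def)
    have "e1 (X (\<eta> g) - frag_of [g]) + C (Z (\<eta> g)) = 0"
      by (rule key) (use XZ[OF k] g in \<open>auto simp: bar_chain_map_diff intro!: bar_chains_diff\<close>)
    then show ?thesis
      by (simp add: d_def e1_def frag_eval_diff algebra_simps)
  qed
  ultimately show ?thesis using that by blast
qed

section \<open>Free groups of countable rank\<close>

type_synonym letter = "nat \<times> bool"

definition flip :: "letter \<Rightarrow> letter" where
  "flip x = (fst x, \<not> snd x)"

lemma flip_flip [simp]: "flip (flip x) = x"
  by (simp add: flip_def)

fun reduced :: "letter list \<Rightarrow> bool" where
  "reduced (x # y # w) \<longleftrightarrow> y \<noteq> flip x \<and> reduced (y # w)"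
| "reduced _ \<longleftrightarrow> True"

fun push :: "letter \<Rightarrow> letter list \<Rightarrow> letter list" where
  "push x [] = [x]"
| "push x (y # w) = (if y = flip x then w else x # y # w)"

definition free_group :: "letter list monoid" where
  "free_group = \<lparr>carrier = {w. reduced w}, monoid.mult = (\<lambda>v w. foldr push v w), one = []\<rparr>"

lemma carrier_free_group [simp]: "w \<in> carrier free_group \<longleftrightarrow> reduced w"
  and mult_free_group: "v \<otimes>\<^bsub>free_group\<^esub> w = foldr push v w"
  and one_free_group [simp]: "\<one>\<^bsub>free_group\<^esub> = []"
  by (simp_all add: free_group_def)

lemma reduced_Cons: "reduced (x # w) \<Longrightarrow> reduced w"
  by (cases w) auto

lemma reduced_push: "reduced w \<Longrightarrow> reduced (push x w)"
  by (cases w) (auto dest: reduced_Cons)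

lemma reduced_foldr_push: "reduced w \<Longrightarrow> reduced (foldr push v w)"
  by (induction v) (auto intro: reduced_push)

lemma push_flip: "reduced w \<Longrightarrow> push x (push (flip x) w) = w"
proof (cases w)
  case (Cons y v)
  assume "reduced w"
  with Cons show ?thesis by (cases v) auto
qed simp

text \<open>
  On reduced words, pushing \<open>x\<close> and pushing its inverse undo each other, so it does not matter whether
  a cancellation takes place before or after \<open>w\<close> is multiplied from the right. Associativity follows.
\<close>

lemma foldr_push_push:
  assumes "reduced v" "reduced w"
  shows "foldr push (push x v) w = push x (foldr push v w)"
proof (cases v)
  case (Cons y u)
  then show ?thesis
    using push_flip[OF reduced_foldr_push[OF assms(2)], of x u] by auto
qed simp

lemma foldr_push_assoc:
  assumes "reduced v" "reduced w"
  shows "foldr push (foldr push u v) w = foldr push u (foldr push v w)"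
  by (induction u) (simp_all add: foldr_push_push reduced_foldr_push assms)

lemma foldr_push_Nil: "reduced w \<Longrightarrow> foldr push w [] = w"
proof (induction w)
  case (Cons x w)
  then show ?case by (cases w) (auto dest: reduced_Cons)
qed simp

lemma ex_reduced_left_inverse: "reduced w \<Longrightarrow> \<exists>v. reduced v \<and> foldr push v w = []"
proof (induction w)
  case (Cons x w)
  then obtain v where v: "reduced v" "foldr push v w = []"
    using reduced_Cons by blast
  have "foldr push (foldr push v [flip x]) (x # w) = foldr push v (push (flip x) (x # w))"
    using Cons.prems by (subst foldr_push_assoc) simp_all
  then show ?case
    using v reduced_foldr_push[of "[flip x]" v] by auto
qed (auto intro: exI[of _ "[]"])

lemma group_free_group: "group free_group"
proof (rule groupI)
  fix x assume "x \<in> carrier free_group"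
  then show "\<exists>y\<in>carrier free_group. y \<otimes>\<^bsub>free_group\<^esub> x = \<one>\<^bsub>free_group\<^esub>"
    using ex_reduced_left_inverse[of x] by (auto simp: mult_free_group)
qed (auto simp: mult_free_group reduced_foldr_push foldr_push_assoc)

interpretation free_group: group free_group
  by (rule group_free_group)

definition gen :: "nat \<Rightarrow> letter list" where
  "gen i = [(i, True)]"

lemma reduced_gen [simp]: "reduced (gen i)"
  by (simp add: gen_def)

lemma letter_free_group: "[(i, s)] = (if s then gen i else inv\<^bsub>free_group\<^esub> (gen i))"
proof (cases s)
  case False
  have "inv\<^bsub>free_group\<^esub> (gen i) = [(i, False)]"
    by (rule free_group.inv_equality) (auto simp: mult_free_group gen_def flip_def)
  with False show ?thesis by simp
qed (simp add: gen_def)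

lemma Cons_free_group: "reduced (x # w) \<Longrightarrow> x # w = [x] \<otimes>\<^bsub>free_group\<^esub> w"
  by (cases w) (auto simp: mult_free_group)

lemma free_group_induct [consumes 1, case_names one gen inv]:
  assumes "w \<in> carrier free_group" "P \<one>\<^bsub>free_group\<^esub>"
    "\<And>i w. w \<in> carrier free_group \<Longrightarrow> P w \<Longrightarrow> P (gen i \<otimes>\<^bsub>free_group\<^esub> w)"
    "\<And>i w. w \<in> carrier free_group \<Longrightarrow> P w \<Longrightarrow> P (inv\<^bsub>free_group\<^esub> gen i \<otimes>\<^bsub>free_group\<^esub> w)"
  shows "P w"
  using assms(1)
proof (induction w)
  case (Cons x w)
  have w: "w \<in> carrier free_group" "P w"
    using Cons reduced_Cons[of x w] by auto
  have "x # w = (if snd x then gen (fst x) else inv\<^bsub>free_group\<^esub> gen (fst x)) \<otimes>\<^bsub>free_group\<^esub> w"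
    using Cons.prems letter_free_group[of "fst x" "snd x"] Cons_free_group[of x w] by simp
  then show ?case
    using assms(3,4)[OF w] by (simp split: if_splits)
qed (use assms(2) in simp)

definition (in group) letter_val :: "(nat \<Rightarrow> 'a) \<Rightarrow> letter \<Rightarrow> 'a" where
  "letter_val p x = (if snd x then p (fst x) else inv (p (fst x)))"

definition (in group) word_val :: "(nat \<Rightarrow> 'a) \<Rightarrow> letter list \<Rightarrow> 'a" where
  "word_val p w = foldr (\<lambda>x y. letter_val p x \<otimes> y) w \<one>"

context group begin

lemma letter_val_closed: "range p \<subseteq> carrier G \<Longrightarrow> letter_val p x \<in> carrier G"
  by (auto simp: letter_val_def)

lemma word_val_closed: "range p \<subseteq> carrier G \<Longrightarrow> word_val p w \<in> carrier G"
  by (induction w) (auto simp: word_val_def letter_val_closed)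

lemma word_val_push:
  assumes "range p \<subseteq> carrier G"
  shows "word_val p (push x w) = letter_val p x \<otimes> word_val p w"
proof (cases w)
  case (Cons y v)
  have "letter_val p x \<otimes> (letter_val p (flip x) \<otimes> word_val p v) = word_val p v"
    using word_val_closed[OF assms, of v] subsetD[OF assms rangeI, of "fst x"]
    by (subst m_assoc[symmetric]) (auto simp: letter_val_def flip_def)
  with Cons show ?thesis by (auto simp: word_val_def)
qed (simp add: word_val_def)

lemma word_val_hom:
  assumes "range p \<subseteq> carrier G"
  shows "word_val p \<in> hom free_group G"
proof -
  have "word_val p (foldr push v w) = word_val p v \<otimes> word_val p w" for v w
  proof (induction v)
    case Nil
    show ?case using word_val_closed[OF assms, of w] by (simp add: word_val_def[of p "[]"])
  next
    case (Cons x v)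
    have "word_val p (x # v) = letter_val p x \<otimes> word_val p v" by (simp add: word_val_def)
    with Cons show ?case
      using word_val_closed[OF assms] letter_val_closed[OF assms]
      by (simp add: word_val_push[OF assms] m_assoc)
  qed
  then show ?thesis
    using word_val_closed[OF assms] by (auto simp: hom_def mult_free_group)
qed

lemma word_val_gen: "range p \<subseteq> carrier G \<Longrightarrow> word_val p (gen i) = p i"
  using subsetD[of "range p" "carrier G" "p i"] by (simp add: word_val_def letter_val_def gen_def)

end

section \<open>The second homology of a free group\<close>

text \<open>
  A 2-chain whose boundary is \<open>[w] - \<Sum>\<plusminus>[s]\<close>, the sum being over the letters of \<open>w\<close>; it is built from
  \<open>\<partial>[x | w] = [w] - [x w] + [x]\<close>, and for the inverse \<open>x\<close> of a generator \<open>s\<close> from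
  \<open>\<partial>[s | x] = [x] - [1] + [s]\<close> and \<open>\<partial>[1 | 1] = [1]\<close>.
\<close>

primrec free_bounding :: "letter list \<Rightarrow> (letter list list \<Rightarrow>\<^sub>0 int)" where
  "free_bounding [] = frag_of [[], []]"
| "free_bounding (x # w) =
     (if snd x then 0 else frag_of [[], []] + frag_of [[flip x], [x]]) + free_bounding w - frag_of [[x], w]"

definition homologous2 :: "(letter list list \<Rightarrow>\<^sub>0 int) \<Rightarrow> (letter list list \<Rightarrow>\<^sub>0 int) \<Rightarrow> bool" (infix \<open>\<sim>\<^sub>2\<close> 50) where
  "a \<sim>\<^sub>2 b \<longleftrightarrow> a - b \<in> bar_boundaries 2 free_group"

lemma homologous2_refl [simp]: "a \<sim>\<^sub>2 a"
  by (simp add: homologous2_def)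

lemma homologous2_trans [trans]: "a \<sim>\<^sub>2 b \<Longrightarrow> b \<sim>\<^sub>2 c \<Longrightarrow> a \<sim>\<^sub>2 c"
  unfolding homologous2_def using bar_boundaries_add[of "a - b" 2 free_group "b - c"] by simp

lemma homologous2_sym: "a \<sim>\<^sub>2 b \<Longrightarrow> b \<sim>\<^sub>2 a"
  unfolding homologous2_def using bar_boundaries_diff[of 0 2 free_group "a - b"] by simp

lemma homologous2_add: "a \<sim>\<^sub>2 b \<Longrightarrow> a' \<sim>\<^sub>2 b' \<Longrightarrow> a + a' \<sim>\<^sub>2 b + b'"
  unfolding homologous2_def using bar_boundaries_add[of "a - b" 2 free_group "a' - b'"]
  by (simp add: algebra_simps)

lemma homologous2_diff: "a \<sim>\<^sub>2 b \<Longrightarrow> a' \<sim>\<^sub>2 b' \<Longrightarrow> a - a' \<sim>\<^sub>2 b - b'"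
  unfolding homologous2_def using bar_boundaries_diff[of "a - b" 2 free_group "a' - b'"]
  by (simp add: algebra_simps)

lemma homologous2_cocycle:
  assumes "reduced a" "reduced b" "reduced c"
  shows "frag_of [a, foldr push b c] \<sim>\<^sub>2 frag_of [foldr push a b, c] + frag_of [a, b] - frag_of [b, c]"
proof -
  have "bar_boundary free_group (frag_of [a, b, c]) \<in> bar_boundaries 2 free_group"
    unfolding bar_boundaries_eq using assms by (intro imageI) (simp add: eval_nat_numeral)
  then show ?thesis
    by (simp add: homologous2_def bar_boundary_symbol3 mult_free_group algebra_simps)
qed

lemma homologous2_one_left: "reduced h \<Longrightarrow> frag_of [[], h] \<sim>\<^sub>2 frag_of [[], []]"
  using homologous2_cocycle[of "[]" "[]" h] by simp

lemma homologous2_one_right: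
  assumes "reduced h"
  shows "frag_of [h, []] \<sim>\<^sub>2 frag_of [[], []]"
proof (rule homologous2_sym)
  show "frag_of [[], []] \<sim>\<^sub>2 frag_of [h, []]"
    using homologous2_cocycle[of h "[]" "[]"] assms by (simp add: foldr_push_Nil homologous2_def)
qed

text \<open>
  If \<open>x h\<close> is reduced this is the recursion for \<open>free_bounding\<close>. Otherwise the first letter of \<open>h\<close> is
  the inverse of \<open>x\<close>, and the cocycle relation for \<open>x\<close>, \<open>x\<inverse>\<close> and the rest of \<open>h\<close> reduces the claim to
  the two letters \<open>x\<close> and \<open>x\<inverse>\<close>.
\<close>

lemma homologous2_letter:
  assumes "reduced h"
  shows "frag_of [[x], h] \<sim>\<^sub>2 free_bounding [x] + free_bounding h - free_bounding (push x h)"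
proof -
  let ?p = "\<lambda>x. if snd x then 0 else frag_of [[], []] + frag_of [[flip x], [x]]"
  have x: "?p x \<sim>\<^sub>2 free_bounding [x]" for x
    using homologous2_diff[OF homologous2_refl homologous2_one_right[of "[x]"], of "?p x + frag_of [[], []]"]
    by (auto simp: algebra_simps intro: homologous2_sym)
  have pp: "frag_of [[], []] + frag_of [[x], [flip x]] \<sim>\<^sub>2 ?p x + ?p (flip x)" for x
  proof (cases "snd x")
    case False
    have "frag_of [[flip x], []] \<sim>\<^sub>2 frag_of [[], [flip x]] + frag_of [[flip x], [x]] - frag_of [[x], [flip x]]"
      using homologous2_cocycle[of "[flip x]" "[x]" "[flip x]"] by (simp add: flip_def)
    moreover have "frag_of [[], [flip x]] \<sim>\<^sub>2 frag_of [[flip x], []]"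
      by (rule homologous2_trans[OF homologous2_one_left homologous2_sym[OF homologous2_one_right]]) simp_all
    ultimately have *: "frag_of [[], [flip x]] \<sim>\<^sub>2 frag_of [[], [flip x]] + frag_of [[flip x], [x]] - frag_of [[x], [flip x]]"
      using homologous2_trans by blast
    have "frag_of [[x], [flip x]] \<sim>\<^sub>2 frag_of [[flip x], [x]]"
      using homologous2_sym[OF homologous2_diff[OF homologous2_refl[of "frag_of [[], [flip x]] + frag_of [[flip x], [x]]"] *]]
      by simp
    with False show ?thesis
      by (auto simp: flip_def intro!: homologous2_add)
  qed (cases x, simp add: flip_def)
  show ?thesis
  proof (cases "\<exists>h'. h = flip x # h'")
    case True
    then obtain h' where h: "h = flip x # h'" by blast
    have h': "reduced h'" using assms h reduced_Cons by blast
    have push: "foldr push [flip x] h' = h" "push x h = h'"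
      using assms h by (cases h'; simp)+
    have "frag_of [[x], h] \<sim>\<^sub>2 frag_of [[], h'] + frag_of [[x], [flip x]] - frag_of [[flip x], h']"
      using homologous2_cocycle[of "[x]" "[flip x]" h'] h' push by simp
    also have "\<dots> \<sim>\<^sub>2 (frag_of [[], []] + frag_of [[x], [flip x]]) - frag_of [[flip x], h']"
      by (intro homologous2_diff homologous2_add homologous2_one_left h' homologous2_refl)
    also have "\<dots> \<sim>\<^sub>2 (?p x + ?p (flip x)) - frag_of [[flip x], h']"
      by (intro homologous2_diff pp homologous2_refl)
    also have "\<dots> = ?p x + (free_bounding h - free_bounding h')"
      by (simp add: h)
    also have "\<dots> \<sim>\<^sub>2 free_bounding [x] + (free_bounding h - free_bounding h')"
      by (intro homologous2_add x homologous2_refl)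
    finally show ?thesis by (simp add: push algebra_simps)
  next
    case False
    then have "push x h = x # h" by (cases h) auto
    then have eq: "free_bounding [x] + free_bounding h - free_bounding (push x h)
        = free_bounding [x] - ?p x + frag_of [[x], h]" by simp
    have "(free_bounding [x] - ?p x) + frag_of [[x], h] \<sim>\<^sub>2 0 + frag_of [[x], h]"
      using homologous2_diff[OF homologous2_sym[OF x[of x]] homologous2_refl[of "?p x"]]
      by (intro homologous2_add homologous2_refl) simp
    from homologous2_sym[OF this] show ?thesis unfolding eq by (simp only: add_0_left)
  qed
qed

text \<open>
  The universal 2-cocycle \<open>(g, h) \<mapsto> [g | h]\<close> modulo boundaries is the coboundary of \<open>free_bounding\<close>.
  The cocycle relation reduces this to the case where \<open>g\<close> is a letter.
\<close>

lemma homologous2_free_bounding: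
  assumes "reduced g" "reduced h"
  shows "frag_of [g, h] \<sim>\<^sub>2 free_bounding g + free_bounding h - free_bounding (foldr push g h)"
  using assms(1)
proof (induction g)
  case Nil
  show ?case using homologous2_one_left[OF assms(2)] by simp
next
  case (Cons x g)
  let ?D = free_bounding
  have g: "reduced g" "push x g = x # g"
    using Cons.prems reduced_Cons[of x g] by (cases g; auto)+
  have "frag_of [[x], foldr push g h] \<sim>\<^sub>2 frag_of [x # g, h] + frag_of [[x], g] - frag_of [g, h]"
    using homologous2_cocycle[of "[x]" g h] g assms(2) by simp
  from homologous2_add[OF homologous2_sym[OF this] homologous2_refl[of "frag_of [g, h] - frag_of [[x], g]"]]
  have "frag_of [x # g, h] \<sim>\<^sub>2 frag_of [[x], foldr push g h] + (frag_of [g, h] - frag_of [[x], g])"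
    by (simp add: algebra_simps)
  also have "\<dots> \<sim>\<^sub>2 (?D [x] + ?D (foldr push g h) - ?D (push x (foldr push g h)))
      + ((?D g + ?D h - ?D (foldr push g h)) - (?D [x] + ?D g - ?D (push x g)))"
    by (intro homologous2_add homologous2_diff homologous2_letter Cons.IH g reduced_foldr_push assms)
  finally show ?case by (simp add: g algebra_simps)
qed

text \<open>
  By \<open>homologous2_free_bounding\<close> any 2-chain \<open>z\<close> is homologous to the linear extension of
  \<open>free_bounding\<close> at \<open>\<partial> z\<close>.
\<close>

lemma free_group_homology_2: "bar_cycles 2 free_group \<subseteq> bar_boundaries 2 free_group"
proof
  fix z assume z: "z \<in> bar_cycles 2 free_group"
  have "z \<sim>\<^sub>2 frag_extend (\<lambda>xs. free_bounding (hd xs)) (bar_boundary free_group z)"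
    if "z \<in> bar_chains 2 free_group" for z
    using that
  proof (induction rule: bar_chains_induct)
    case (one xs)
    then obtain g h where "xs = [g, h]" "reduced g" "reduced h"
      by (auto simp: length2_conv)
    then show ?case
      using homologous2_free_bounding[of g h]
      by (simp add: bar_boundary_symbol2 frag_extend_add frag_extend_diff mult_free_group algebra_simps)
  qed (auto simp: bar_boundary_diff frag_extend_diff intro: homologous2_diff)
  from this[of z] z show "z \<in> bar_boundaries 2 free_group"
    by (simp add: bar_cycles_eq homologous2_def)
qed

lemma reduced_inv [simp]: "reduced w \<Longrightarrow> reduced (inv\<^bsub>free_group\<^esub> w)"
  using free_group.inv_closed[of w] by simp

lemma reduced_mult [simp]: "reduced v \<Longrightarrow> reduced w \<Longrightarrow> reduced (v \<otimes>\<^bsub>free_group\<^esub> w)"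
  using free_group.m_closed[of v w] by simp

section \<open>The first homology of a free group\<close>

definition exponents :: "letter list \<Rightarrow> (nat \<Rightarrow>\<^sub>0 int)" where
  "exponents w = (\<Sum>x\<leftarrow>w. if snd x then frag_of (fst x) else - frag_of (fst x))"

lemma exponents_simps [simp]:
  "exponents [] = 0" "exponents (x # w) = (if snd x then frag_of (fst x) else - frag_of (fst x)) + exponents w"
  by (simp_all add: exponents_def)

lemma exponents_push: "exponents (push x w) = exponents [x] + exponents w"
  by (cases w) (auto simp: flip_def)

lemma exponents_mult: "exponents (v \<otimes>\<^bsub>free_group\<^esub> w) = exponents v + exponents w"
  unfolding mult_free_group by (induction v) (simp_all add: exponents_push)

lemma exponents_inv:
  assumes "reduced w"
  shows "exponents (inv\<^bsub>free_group\<^esub> w) = - exponents w"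
proof -
  have "exponents (inv\<^bsub>free_group\<^esub> w \<otimes>\<^bsub>free_group\<^esub> w) = 0"
    using assms by (subst free_group.l_inv) simp_all
  then show ?thesis unfolding exponents_mult by (simp add: eq_neg_iff_add_eq_0)
qed

definition chain_exponents :: "(letter list list \<Rightarrow>\<^sub>0 int) \<Rightarrow> (nat \<Rightarrow>\<^sub>0 int)" where
  "chain_exponents = frag_extend (\<lambda>xs. exponents (hd xs))"

definition gen_chain :: "(nat \<Rightarrow>\<^sub>0 int) \<Rightarrow> (letter list list \<Rightarrow>\<^sub>0 int)" where
  "gen_chain = frag_extend (\<lambda>i. frag_of [gen i])"

lemma chain_exponents_boundary:
  "z \<in> bar_chains 2 free_group \<Longrightarrow> chain_exponents (bar_boundary free_group z) = 0"
  by (induction rule: bar_chains_induct)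
     (auto simp: chain_exponents_def length2_conv bar_boundary_symbol2 bar_boundary_diff
        frag_extend_add frag_extend_diff exponents_mult)

lemma (in group) bar_boundaries_1_mult:
  assumes "a \<in> carrier G" "b \<in> carrier G"
  shows "frag_of [b] - frag_of [a \<otimes> b] + frag_of [a] \<in> bar_boundaries 1 G"
  unfolding bar_boundaries_eq bar_boundary_symbol2[symmetric]
  using assms by (intro imageI) (simp add: eval_nat_numeral)

lemma word_homologous_gen_chain:
  assumes "w \<in> carrier free_group"
  shows "frag_of [w] - gen_chain (exponents w) \<in> bar_boundaries 1 free_group" (is "?P w")
  using assms
proof (induction w rule: free_group_induct)
  case one
  show ?case using free_group.bar_boundaries_1_mult[of "[]" "[]"]
    by (simp add: gen_chain_def mult_free_group)
next
  case (gen i w)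
  have "frag_of [w] - gen_chain (exponents w) - (frag_of [w] - frag_of [gen i \<otimes>\<^bsub>free_group\<^esub> w] + frag_of [gen i])
      \<in> bar_boundaries 1 free_group"
    using gen(1) by (intro bar_boundaries_diff[OF gen(2)] free_group.bar_boundaries_1_mult) auto
  moreover have "exponents (gen i) = frag_of i" by (simp add: gen_def)
  ultimately show ?case
    by (simp add: exponents_mult gen_chain_def frag_extend_add algebra_simps)
next
  case (inv i w)
  let ?g = "inv\<^bsub>free_group\<^esub> gen i"
  have "frag_of [?g \<otimes>\<^bsub>free_group\<^esub> w] - frag_of [gen i \<otimes>\<^bsub>free_group\<^esub> (?g \<otimes>\<^bsub>free_group\<^esub> w)] + frag_of [gen i]
      \<in> bar_boundaries 1 free_group"
    using inv(1) by (intro free_group.bar_boundaries_1_mult free_group.m_closed free_group.inv_closed) auto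
  moreover have "gen i \<otimes>\<^bsub>free_group\<^esub> (?g \<otimes>\<^bsub>free_group\<^esub> w) = w"
    using inv(1) by (subst free_group.m_assoc[symmetric]) (auto simp: free_group.inv_closed)
  ultimately have "frag_of [?g \<otimes>\<^bsub>free_group\<^esub> w] - frag_of [w] + frag_of [gen i]
      + (frag_of [w] - gen_chain (exponents w)) \<in> bar_boundaries 1 free_group"
    by (intro bar_boundaries_add[OF _ inv(2)]) simp
  moreover have "exponents (gen i) = frag_of i" by (simp add: gen_def)
  ultimately show ?case
    by (simp add: exponents_mult exponents_inv gen_chain_def frag_extend_add frag_extend_diff frag_extend_minus algebra_simps)
qed

lemma bar_boundaries_1_free_group_iff:
  assumes "y \<in> bar_chains 1 free_group"
  shows "y \<in> bar_boundaries 1 free_group \<longleftrightarrow> chain_exponents y = 0"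
proof
  assume "y \<in> bar_boundaries 1 free_group"
  then show "chain_exponents y = 0"
    using chain_exponents_boundary by (auto simp: bar_boundaries_eq eval_nat_numeral)
next
  assume 0: "chain_exponents y = 0"
  have "y - gen_chain (chain_exponents y) \<in> bar_boundaries 1 free_group"
    using assms
  proof (induction rule: bar_chains_induct)
    case (one xs)
    then obtain w where "xs = [w]" "w \<in> carrier free_group" by (auto simp: length_Suc_conv)
    then show ?case using word_homologous_gen_chain[of w] by (simp add: chain_exponents_def)
  next
    case (diff a b)
    then show ?case
      using bar_boundaries_diff[OF diff]
      by (simp add: chain_exponents_def gen_chain_def frag_extend_diff algebra_simps)
  qed (simp add: chain_exponents_def gen_chain_def)
  then show "y \<in> bar_boundaries 1 free_group"
    by (simp add: 0 gen_chain_def)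
qed

text \<open>
  Since \<open>H\<^sub>2\<close> of a free group is zero, an endomorphism is an \<open>H\<int>\<close>-map as soon as it is invertible
  on \<open>H\<^sub>1\<close>, the free abelian group on the generators; the inverse is given by \<open>\<beta>\<close>.
\<close>

proposition HZ_map_free_group:
  assumes f: "f \<in> hom free_group free_group"
    and \<alpha>: "\<And>i. exponents (f (gen i)) = \<alpha> i"
    and \<alpha>\<beta>: "\<And>i. frag_extend \<alpha> (\<beta> i) = frag_of i"
    and \<beta>\<alpha>: "\<And>i. frag_extend \<beta> (\<alpha> i) = frag_of i"
  shows "HZ_map free_group free_group f"
proof -
  have inverse: "frag_extend \<phi> (frag_extend \<psi> c) = c"
    if "\<And>i. frag_extend \<phi> (\<psi> i) = frag_of i" for \<phi> \<psi> :: "nat \<Rightarrow> nat \<Rightarrow>\<^sub>0 int" and c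
    using subset_UNIV
    by (induction c rule: frag_induction) (simp_all add: that frag_extend_diff)
  have fc: "f \<in> carrier free_group \<rightarrow> carrier free_group"
    using f by (simp add: hom_def)
  interpret f: group_hom free_group free_group f
    using f by unfold_locales
  have word: "exponents (f w) = frag_extend \<alpha> (exponents w)" if "w \<in> carrier free_group" for w
    using that
  proof (induction rule: free_group_induct)
    case one
    then show ?case using f.hom_one by simp
  next
    case (gen i w)
    then show ?case
      by (simp add: exponents_mult frag_extend_add \<alpha>) (simp add: gen_def)
  next
    case (inv i w)
    then show ?case
      using funcset_mem[OF fc, of "gen i"]
      by (simp add: exponents_mult exponents_inv frag_extend_add frag_extend_diff frag_extend_minus \<alpha>)
         (simp add: gen_def)
  qed
  have chain: "chain_exponents (bar_chain_map f y) = frag_extend \<alpha> (chain_exponents y)"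
    if "y \<in> bar_chains 1 free_group" for y
    using that
  proof (induction rule: bar_chains_induct)
    case (one xs)
    then show ?case using word by (auto simp: chain_exponents_def length_Suc_conv)
  qed (simp_all add: chain_exponents_def bar_chain_map_diff frag_extend_diff)
  have "homology_inj 1 free_group free_group f"
    unfolding homology_inj_def bar_cycles_1
  proof (intro ballI impI)
    fix x assume x: "x \<in> bar_chains 1 free_group" "bar_chain_map f x \<in> bar_boundaries 1 free_group"
    then have "frag_extend \<alpha> (chain_exponents x) = 0"
      using chain[OF x(1)] bar_boundaries_1_free_group_iff[OF bar_chain_map_chains[OF fc x(1)]] by simp
    then have "chain_exponents x = 0"
      using inverse[OF \<beta>\<alpha>, of "chain_exponents x"] by simp
    then show "x \<in> bar_boundaries 1 free_group"
      using bar_boundaries_1_free_group_iff[OF x(1)] by simp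
  qed
  moreover have "homology_surj 1 free_group free_group f"
    unfolding homology_surj_def bar_cycles_1
  proof
    fix y assume y: "y \<in> bar_chains 1 free_group"
    define x where "x = gen_chain (frag_extend \<beta> (chain_exponents y))"
    have gen_chain: "gen_chain c \<in> bar_chains 1 free_group \<and> chain_exponents (gen_chain c) = c" for c
      using subset_UNIV
      by (induction c rule: frag_induction)
         (auto simp: gen_chain_def chain_exponents_def frag_extend_diff gen_def intro: bar_chains_diff)
    have x: "x \<in> bar_chains 1 free_group" "chain_exponents x = frag_extend \<beta> (chain_exponents y)"
      using gen_chain by (simp_all add: x_def)
    have "chain_exponents (y - bar_chain_map f x) = 0"
      using chain[OF x(1)] x(2) inverse[OF \<alpha>\<beta>, of "chain_exponents y"]
      by (simp add: chain_exponents_def frag_extend_diff)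
    then have "y - bar_chain_map f x \<in> bar_boundaries 1 free_group"
      using bar_boundaries_1_free_group_iff bar_chains_diff[OF y bar_chain_map_chains[OF fc x(1)]] by blast
    then show "\<exists>x\<in>bar_chains 1 free_group. y - bar_chain_map f x \<in> bar_boundaries 1 free_group"
      using x(1) by blast
  qed
  moreover have "homology_surj 2 free_group free_group f"
    unfolding homology_surj_def
  proof
    fix y assume "y \<in> bar_cycles 2 free_group"
    then have "y - bar_chain_map f 0 \<in> bar_boundaries 2 free_group"
      using free_group_homology_2 by auto
    moreover have "0 \<in> bar_cycles 2 free_group" by (simp add: bar_cycles_eq)
    ultimately show "\<exists>x\<in>bar_cycles 2 free_group. y - bar_chain_map f x \<in> bar_boundaries 2 free_group"
      by blast
  qed
  ultimately show ?thesis
    using f group_free_group by (simp add: HZ_map_iff)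
qed

section \<open>Equations in local groups\<close>

text \<open>
  Locality is tested on groups carried by one fixed type, but applies to all \<open>H\<int>\<close>-maps between groups
  that embed into this type as sets, by transport of structure.
\<close>

lemma HZ_local_extend:
  fixes A :: "('a, 'b) monoid_scheme" and B :: "('c, 'd) monoid_scheme"
    and \<iota> :: "'a \<Rightarrow> 'u" and \<kappa> :: "'c \<Rightarrow> 'u"
  assumes loc: "HZ_local TYPE('u) \<Gamma>" and f: "HZ_map A B f" and \<phi>: "\<phi> \<in> hom A \<Gamma>"
    and \<iota>: "inj_on \<iota> (carrier A)" and \<kappa>: "inj_on \<kappa> (carrier B)"
  obtains \<psi> where "\<psi> \<in> hom B \<Gamma>" "\<And>x. x \<in> carrier A \<Longrightarrow> \<psi> (f x) = \<phi> x"
proof -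
  have A: "group A" and B: "group B" and fh: "f \<in> hom A B"
    using f by (simp_all add: HZ_map_iff)
  let ?A = "image_group \<iota> A"
  let ?B = "image_group \<kappa> B"
  define i where "i = inv_into (carrier A) \<iota>"
  have gA: "group ?A" and gB: "group ?B"
    using group.inj_imp_image_group_is_group A B \<iota> \<kappa> by blast+
  have \<iota>_iso: "\<iota> \<in> iso A ?A" and \<kappa>_iso: "\<kappa> \<in> iso B ?B"
    using inj_imp_image_group_iso \<iota> \<kappa> by blast+
  have i_iso: "i \<in> iso ?A A"
    using group.iso_set_sym[OF A \<iota>_iso] by (simp add: i_def)
  have i\<iota>: "i (\<iota> x) = x" if "x \<in> carrier A" for x
    using that \<iota> by (simp add: i_def)
  define h where "h = \<kappa> \<circ> f \<circ> i"
  have "HZ_map ?A ?B h"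
    unfolding h_def
    by (intro HZ_map_compose[where H = A] HZ_map_compose[where H = B] HZ_map_iso f i_iso \<kappa>_iso A B gA gB)
  then have bij: "bij_betw (\<lambda>\<phi>. compose (carrier ?A) \<phi> h) (Hom ?B \<Gamma>) (Hom ?A \<Gamma>)"
    using loc by (simp add: HZ_local_def)
  define \<phi>' where "\<phi>' = restrict (\<phi> \<circ> i) (carrier ?A)"
  have "\<phi> \<circ> i \<in> hom ?A \<Gamma>"
    using i_iso \<phi> by (intro hom_compose[of _ _ A]) (simp_all add: iso_def)
  then have "\<phi>' \<in> Hom ?A \<Gamma>"
    using group.is_monoid[OF gA]
    by (auto simp: \<phi>'_def Hom_def hom_def monoid.m_closed)
  then obtain \<psi> where \<psi>: "\<psi> \<in> Hom ?B \<Gamma>" "compose (carrier ?A) \<psi> h = \<phi>'"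
    using bij unfolding bij_betw_def by (metis (no_types, lifting) imageE)
  have "\<psi> \<circ> \<kappa> \<in> hom B \<Gamma>"
    using \<psi>(1) \<kappa>_iso by (intro hom_compose[of _ _ ?B]) (simp_all add: iso_def Hom_def)
  moreover have "(\<psi> \<circ> \<kappa>) (f x) = \<phi> x" if x: "x \<in> carrier A" for x
  proof -
    have "\<iota> x \<in> carrier ?A" using x by (simp add: image_group_def)
    then show ?thesis
      using fun_cong[OF \<psi>(2), of "\<iota> x"] i\<iota>[OF x]
      by (simp add: compose_def \<phi>'_def h_def)
  qed
  ultimately show thesis using that by blast
qed

text \<open>
  Take free generators \<open>T\<close>, \<open>U\<^sub>n\<close> and \<open>X\<^sub>n\<close>, and let \<open>f\<close> fix \<open>T\<close> and the \<open>U\<^sub>n\<close> and send \<open>X\<^sub>n\<close> to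
  \<open>X\<^sub>n\<inverse> U\<^sub>n [X\<^bsub>n+1\<^esub>, T]\<close>. On \<open>H\<^sub>1\<close> it is the involution \<open>X\<^sub>n \<mapsto> U\<^sub>n - X\<^sub>n\<close>, so \<open>f\<close> is an \<open>H\<int>\<close>-map.
  The homomorphism with \<open>T \<mapsto> t\<close>, \<open>U\<^sub>n \<mapsto> u\<^sub>n\<close> and \<open>X\<^sub>n \<mapsto> 1\<close> therefore factors as \<open>\<psi> \<circ> f\<close>, which says that
  the elements \<open>\<psi> X\<^sub>n\<close> solve the system.
\<close>

theorem HZ_local_solve_tower:
  fixes \<Gamma> :: "('g, 'h) monoid_scheme" and u :: "nat \<Rightarrow> 'g" and \<iota> :: "letter list \<Rightarrow> 'u"
  assumes loc: "HZ_local TYPE('u) \<Gamma>" and \<iota>: "inj \<iota>"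
    and u: "\<And>n. u n \<in> carrier \<Gamma>" and t: "t \<in> carrier \<Gamma>"
  obtains x where "\<And>n. x n \<in> carrier \<Gamma>"
    "\<And>n. x n = u n \<otimes>\<^bsub>\<Gamma>\<^esub>
       (x (Suc n) \<otimes>\<^bsub>\<Gamma>\<^esub> t \<otimes>\<^bsub>\<Gamma>\<^esub> inv\<^bsub>\<Gamma>\<^esub> x (Suc n) \<otimes>\<^bsub>\<Gamma>\<^esub> inv\<^bsub>\<Gamma>\<^esub> t)"
proof -
  interpret \<Gamma>: group \<Gamma> using loc by (simp add: HZ_local_def)
  let ?F = free_group
  define T where "T = gen 0"
  define U where "U n = gen (2 * n + 1)" for n
  define X where "X n = gen (2 * n + 2)" for n
  define rhs where "rhs n = U n \<otimes>\<^bsub>?F\<^esub>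
      (X (Suc n) \<otimes>\<^bsub>?F\<^esub> T \<otimes>\<^bsub>?F\<^esub> inv\<^bsub>?F\<^esub> X (Suc n) \<otimes>\<^bsub>?F\<^esub> inv\<^bsub>?F\<^esub> T)" for n
  have [simp]: "reduced T" "reduced (U n)" "reduced (X n)" "reduced (rhs n)" for n
    by (simp_all add: T_def U_def X_def rhs_def)
  \<comment> \<open>Generator \<open>0\<close> is \<open>T\<close>, the odd ones are the \<open>U n\<close>, and the positive even ones the \<open>X n\<close>.\<close>
  define unknown where "unknown i \<longleftrightarrow> even i \<and> i \<noteq> 0" for i :: nat
  define p where "p i = (if unknown i then inv\<^bsub>?F\<^esub> gen i \<otimes>\<^bsub>?F\<^esub> rhs (i div 2 - 1) else gen i)" for i
  define f where "f = free_group.word_val p"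
  have p: "range p \<subseteq> carrier ?F"
    by (auto simp: p_def)
  have f: "f \<in> hom ?F ?F" and f_gen: "f (gen i) = p i" for i
    using free_group.word_val_hom[OF p] free_group.word_val_gen[OF p] by (simp_all add: f_def)
  define \<alpha> :: "nat \<Rightarrow> nat \<Rightarrow>\<^sub>0 int"
    where "\<alpha> i = (if unknown i then frag_of (i - 1) - frag_of i else frag_of i)" for i
  have exponents_gen: "exponents (gen i) = frag_of i" for i
    by (simp add: gen_def)
  have HZ: "HZ_map ?F ?F f"
  proof (rule HZ_map_free_group[OF f])
    show "exponents (f (gen i)) = \<alpha> i" for i
    proof (cases "unknown i")
      case True
      then obtain n where "i = 2 * n + 2"
        unfolding unknown_def by (metis evenE mult_Suc_right not0_implies_Suc mult_0_right add.commute)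
      then show ?thesis
        by (simp add: f_gen p_def \<alpha>_def unknown_def rhs_def exponents_mult exponents_inv U_def exponents_gen)
    next
      case False
      then show ?thesis by (simp add: f_gen p_def \<alpha>_def exponents_gen)
    qed
    show "frag_extend \<alpha> (\<alpha> i) = frag_of i" for i
      by (auto simp: \<alpha>_def frag_extend_diff unknown_def)
    then show "frag_extend \<alpha> (\<alpha> i) = frag_of i" for i .
  qed
  define q where "q i = (if i = 0 then t else if odd i then u (i div 2) else \<one>\<^bsub>\<Gamma>\<^esub>)" for i :: nat
  have q: "range q \<subseteq> carrier \<Gamma>" using u t by (auto simp: q_def)
  have inj: "inj_on \<iota> (carrier ?F)" using \<iota> by (rule inj_on_subset) simp
  obtain \<psi> where \<psi>: "\<psi> \<in> hom ?F \<Gamma>" "\<And>x. x \<in> carrier ?F \<Longrightarrow> \<psi> (f x) = \<Gamma>.word_val q x"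
    using HZ_local_extend[OF loc HZ \<Gamma>.word_val_hom[OF q] inj inj] by blast
  interpret \<psi>: group_hom ?F \<Gamma> \<psi> using \<psi>(1) by unfold_locales
  have \<psi>_gen: "\<psi> (p i) = q i" for i
    using \<psi>(2)[of "gen i"] by (simp add: f_gen \<Gamma>.word_val_gen[OF q])
  have \<psi>T: "\<psi> T = t" and \<psi>U: "\<psi> (U n) = u n" for n
    using \<psi>_gen[of 0] \<psi>_gen[of "2 * n + 1"] by (simp_all add: p_def q_def T_def U_def unknown_def)
  define x where "x n = \<psi> (X n)" for n
  have x: "x n \<in> carrier \<Gamma>" for n by (simp add: x_def \<psi>.hom_closed)
  have "x n = \<psi> (rhs n)" for n
  proof -
    have "\<psi> (inv\<^bsub>?F\<^esub> X n \<otimes>\<^bsub>?F\<^esub> rhs n) = \<one>\<^bsub>\<Gamma>\<^esub>"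
      using \<psi>_gen[of "2 * n + 2"] by (simp add: p_def q_def unknown_def X_def)
    then have "inv\<^bsub>\<Gamma>\<^esub> x n \<otimes>\<^bsub>\<Gamma>\<^esub> \<psi> (rhs n) = \<one>\<^bsub>\<Gamma>\<^esub>"
      by (simp add: x_def)
    then show ?thesis
      using x[of n] \<psi>.hom_closed[of "rhs n"]
      by (metis \<Gamma>.inv_equality \<Gamma>.inv_inv \<Gamma>.inv_closed carrier_free_group \<open>reduced (rhs n)\<close>)
  qed
  moreover have "\<psi> (rhs n) = u n \<otimes>\<^bsub>\<Gamma>\<^esub>
       (x (Suc n) \<otimes>\<^bsub>\<Gamma>\<^esub> t \<otimes>\<^bsub>\<Gamma>\<^esub> inv\<^bsub>\<Gamma>\<^esub> x (Suc n) \<otimes>\<^bsub>\<Gamma>\<^esub> inv\<^bsub>\<Gamma>\<^esub> t)" for n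
    by (simp add: rhs_def \<psi>T \<psi>U x_def)
  ultimately show thesis using that x by metis
qed

section \<open>The lower central series up to \<open>\<omega> + 1\<close>\<close>

lemma Well_order_omega_plus_one: "Well_order omega_plus_one"
proof -
  have mem: "(x, y) \<in> omega_plus_one \<longleftrightarrow>
      (case y of None \<Rightarrow> True | Some n \<Rightarrow> (case x of None \<Rightarrow> False | Some m \<Rightarrow> m \<le> n))" for x y
    unfolding ord_succ_def Field_natLeq by (cases x; cases y) (auto simp: natLeq_def)
  have F: "Field omega_plus_one = UNIV"
    using mem[of _ None] FieldI1[of _ None omega_plus_one] by auto
  have "omega_plus_one - Id \<subseteq> inv_image (less_than <*lex*> less_than) (\<lambda>x. case x of Some n \<Rightarrow> (0, n) | None \<Rightarrow> (1, 0))"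
    by (auto simp: mem split: option.splits)
  then have "wf (omega_plus_one - Id)"
    by (rule wf_subset[rotated]) (intro wf_inv_image wf_lex_prod wf_less_than)
  moreover have "Linear_order omega_plus_one"
    unfolding F order_on_defs
    by (auto simp: refl_on_def trans_def antisym_def total_on_def mem split: option.splits)
  ultimately show ?thesis by (simp add: well_order_on_def)
qed

lemma natLeq_finite_Field: "s <o natLeq \<Longrightarrow> finite (Field s)"
proof (rule ccontr)
  assume s: "s <o natLeq" and inf: "infinite (Field s)"
  have W: "Well_order s" using ordLess_Well_order_simp[OF s] by (rule conjunct1)
  obtain n where "s =o natLeq_on n"
    using s ordLess_iff_ordIso_Restr[OF natLeq_Well_order W] by (auto simp: Restr_natLeq2)
  moreover have "natLeq_on n <o s"
    by (rule finite_ordLess_infinite[OF natLeq_on_Well_order W _ inf]) (simp add: Field_natLeq_on)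
  ultimately show False
    using not_ordLess_ordIso ordIso_symmetric by blast
qed

lemma ordLess_omega_plus_one:
  assumes "s <o omega_plus_one"
  shows "s \<le>o natLeq"
proof -
  have W: "Well_order s" using ordLess_Well_order_simp[OF assms] by (rule conjunct1)
  obtain a where a: "s =o Restr omega_plus_one (underS omega_plus_one a)"
    using assms ordLess_iff_ordIso_Restr[OF Well_order_omega_plus_one W] by auto
  show ?thesis
  proof (cases a)
    case None
    have "Restr omega_plus_one (underS omega_plus_one a) = dir_image natLeq Some"
      by (auto simp: None ord_succ_def underS_def dir_image_def natLeq_def Field_def)
    then have "natLeq =o Restr omega_plus_one (underS omega_plus_one a)"
      using dir_image_ordIso[OF natLeq_Well_order, of Some] by simp
    then show ?thesis
      using a ordIso_transitive ordIso_symmetric ordIso_imp_ordLeq by metis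
  next
    case (Some n)
    let ?p = "Restr omega_plus_one (underS omega_plus_one a)"
    have "underS omega_plus_one a \<subseteq> Some ` {..n}"
      by (auto simp: Some ord_succ_def underS_def natLeq_def)
    then have "finite (underS omega_plus_one a)"
      by (rule finite_subset) simp
    then have "finite (Field ?p)"
      using Field_Restr_subset finite_subset by metis
    then have "?p <o natLeq"
      using Well_order_Restr[OF Well_order_omega_plus_one]
      by (intro finite_ordLess_infinite natLeq_Well_order) (simp_all add: Field_natLeq)
    then show ?thesis
      using a ordIso_ordLess_trans ordLess_imp_ordLeq by metis
  qed
qed

lemma Field_initial_seg:
  assumes "Well_order r"
  shows "Field (initial_seg r i) = underS r i"
proof -
  have "Refl r" using assms by (simp add: order_on_defs)
  then show ?thesis
    unfolding initial_seg_def by (subst Refl_Field_Restr) (auto simp: underS_def Field_def)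
qed

lemma initial_seg_ordLess: "Well_order r \<Longrightarrow> i \<in> Field r \<Longrightarrow> initial_seg r i <o r"
  unfolding initial_seg_def by (rule underS_Restr_ordLess) auto

lemma the_is_last:
  assumes "Well_order r" "is_last r m"
  shows "(THE m. is_last r m) = m"
proof -
  have "antisym r" using assms(1) by (simp add: order_on_defs)
  then show ?thesis
    using assms(2) by (intro the_equality) (auto simp: is_last_def antisym_def)
qed

lemma Field_minus_last:
  assumes "Well_order r" "is_last r m"
  shows "Field (initial_seg r m) = Field r - {m}"
  unfolding Field_initial_seg[OF assms(1)]
  using assms(2) by (auto simp: underS_def is_last_def Field_def)

lemma finite_Well_order_last:
  assumes "Well_order r" "finite (Field r)" "Field r \<noteq> {}"
  shows "\<exists>m. is_last r m"
proof -
  have fin: "finite A \<Longrightarrow> A \<noteq> {} \<Longrightarrow> A \<subseteq> Field r \<Longrightarrow> \<exists>m\<in>A. \<forall>i\<in>A. (i, m) \<in> r" for A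
  proof (induction A rule: finite_ne_induct)
    case (singleton x)
    then show ?case using assms(1) by (auto simp: order_on_defs refl_on_def)
  next
    case (insert x A)
    then obtain m where m: "m \<in> A" "\<forall>i\<in>A. (i, m) \<in> r" by auto
    have "(x, x) \<in> r" "(m, m) \<in> r"
      using assms(1) insert.prems m(1) by (auto simp: order_on_defs refl_on_def)
    moreover from this have "(x, m) \<in> r \<or> (m, x) \<in> r"
      using assms(1) insert.prems m(1) by (cases "x = m") (auto simp: order_on_defs total_on_def)
    moreover have "trans r" using assms(1) by (simp add: order_on_defs)
    ultimately show ?case using m unfolding trans_def by (metis insert_iff)
  qed
  from fin[OF assms(2,3)] show ?thesis by (auto simp: is_last_def)
qed

abbreviation (in group) commutator :: "'a \<Rightarrow> 'a \<Rightarrow> 'a" where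
  "commutator a b \<equiv> a \<otimes> b \<otimes> inv a \<otimes> inv b"

context group begin

primrec lcs :: "nat \<Rightarrow> 'a set" where
  "lcs 0 = carrier G"
| "lcs (Suc n) = commutator_subgroup G (lcs n) (carrier G)"

lemma lcs_normal: "lcs n \<lhd> G"
proof (induction n)
  case 0
  show ?case using subgroup_self by (intro normal_invI) auto
next
  case (Suc n)
  interpret N: normal "lcs n" G by (rule Suc)
  have conj: "g \<otimes> (a \<otimes> b \<otimes> inv a \<otimes> inv b) \<otimes> inv g =
      (g \<otimes> a \<otimes> inv g) \<otimes> (g \<otimes> b \<otimes> inv g) \<otimes> inv (g \<otimes> a \<otimes> inv g) \<otimes> inv (g \<otimes> b \<otimes> inv g)"
    if "g \<in> carrier G" "a \<in> carrier G" "b \<in> carrier G" for g a b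
    using that by (simp add: inv_mult_group m_assoc inv_solve_left' flip: m_assoc[of "inv g" g])
  show ?case
    unfolding lcs.simps commutator_subgroup_def
  proof (rule normal_generateI)
    fix h g
    assume "h \<in> {a \<otimes> b \<otimes> inv a \<otimes> inv b |a b. a \<in> lcs n \<and> b \<in> carrier G}" and g: "g \<in> carrier G"
    then obtain a b where h: "h = a \<otimes> b \<otimes> inv a \<otimes> inv b" "a \<in> lcs n" "b \<in> carrier G" by blast
    moreover have "g \<otimes> a \<otimes> inv g \<in> lcs n"
      using N.inv_op_closed2[OF g h(2)] .
    ultimately show "g \<otimes> h \<otimes> inv g \<in> {a \<otimes> b \<otimes> inv a \<otimes> inv b |a b. a \<in> lcs n \<and> b \<in> carrier G}"
      using conj[OF g N.mem_carrier[OF h(2)] h(3)] g by blast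
  qed (use N.subset in auto)
qed

lemma commutator_in_lcs:
  assumes "a \<in> lcs n" "b \<in> carrier G"
  shows "a \<otimes> b \<otimes> inv a \<otimes> inv b \<in> lcs (Suc n)"
  using assms by (auto simp: commutator_subgroup_def intro!: generate.incl)

lemma commutator_subgroup_mono: "A \<subseteq> A' \<Longrightarrow> commutator_subgroup G A B \<subseteq> commutator_subgroup G A' B"
  unfolding commutator_subgroup_def by (intro mono_generate) blast

lemma lower_central_cases:
  assumes "Well_order r"
  obtains
    (small) "lower_central G r = carrier G" "\<exists>x. Field r \<subseteq> {x}"
  | (last) m where "is_last r m"
      "lower_central G r = commutator_subgroup G (lower_central G (initial_seg r m)) (carrier G)"
      "\<not> (\<exists>x. Field r \<subseteq> {x})"
  | (limit) "lower_central G r = (\<Inter>i\<in>Field r. lower_central G (initial_seg r i))"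
      "\<nexists>m. is_last r m"
proof (cases "\<exists>x. Field r \<subseteq> {x}")
  case True
  then show thesis using small by (simp add: lower_central.simps)
next
  case False
  then show thesis
    using assms last limit the_is_last[OF assms]
    by (cases "\<exists>m. is_last r m") (auto simp: lower_central.simps[of G r])
qed

text \<open>
  The series \<open>lower_central\<close> starts at the ordinal \<open>1\<close>, while \<open>lcs\<close> starts at \<open>0\<close>; this explains the
  index \<open>card (Field r) - 1\<close>.
\<close>

lemma lcs_lower_central_finite:
  assumes "Well_order r" "finite (Field r)"
  shows "lcs (card (Field r) - 1) \<subseteq> lower_central G r"
  using assms
proof (induction "card (Field r)" arbitrary: r rule: less_induct)
  case less
  from less.prems(1) show ?case
  proof (cases rule: lower_central_cases)
    case small
    then show ?thesis using normal_imp_subgroup[OF lcs_normal] subgroup.subset by blast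
  next
    case (last m)
    have mF: "m \<in> Field r" using last(1) by (simp add: is_last_def)
    have F: "Field (initial_seg r m) = Field r - {m}"
      using Field_minus_last[OF less.prems(1) last(1)] .
    have card: "card (Field (initial_seg r m)) = card (Field r) - 1"
      using F mF by simp
    have pos: "card (Field r) > 0"
      using less.prems(2) mF by (auto simp: card_gt_0_iff)
    have "card (Field r) \<noteq> 1" using last(3) by (auto simp: card_1_singleton_iff)
    have "lcs (card (Field (initial_seg r m)) - 1) \<subseteq> lower_central G (initial_seg r m)"
    proof (rule less.hyps)
      show "Well_order (initial_seg r m)"
        unfolding initial_seg_def by (rule Well_order_Restr[OF less.prems(1)])
    qed (use card pos less.prems(2) F in auto)
    then have "lcs (Suc (card (Field r) - 1 - 1)) \<subseteq> lower_central G r"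
      unfolding last(2) lcs.simps card by (rule commutator_subgroup_mono)
    then show ?thesis using pos \<open>card (Field r) \<noteq> 1\<close> by (simp add: Suc_diff_Suc)
  next
    case limit
    then have "Field r = {}" using finite_Well_order_last[OF less.prems] by blast
    then show ?thesis using limit(1) by simp
  qed
qed

text \<open>
  Proper initial segments of \<open>s\<close> are finite, so either \<open>s\<close> is finite itself or it is a limit and the
  term at \<open>s\<close> is the intersection of terms at finite ordinals.
\<close>

lemma lower_central_omega:
  assumes "s \<le>o natLeq" "\<And>n. v \<in> lcs n"
  shows "v \<in> lower_central G s"
proof -
  have W: "Well_order s" using ordLeq_Well_order_simp[OF assms(1)] by (rule conjunct1)
  have finite_seg: "finite (Field (initial_seg s i))" if "i \<in> Field s" for i
    using ordLess_ordLeq_trans[OF initial_seg_ordLess[OF W that] assms(1)] by (rule natLeq_finite_Field)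
  have fin: "v \<in> lower_central G r" if "Well_order r" "finite (Field r)" for r :: "'z rel"
    using lcs_lower_central_finite[OF that] assms(2) by blast
  show ?thesis
    using W
  proof (cases rule: lower_central_cases)
    case small
    then show ?thesis using assms(2)[of 0] by simp
  next
    case (last m)
    have "finite (Field s - {m})"
      using finite_seg[of m] last(1) Field_minus_last[OF W last(1)] by (simp add: is_last_def)
    then show ?thesis using fin[OF W] by simp
  next
    case limit
    show ?thesis
      unfolding limit(1)
    proof
      fix i assume "i \<in> Field s"
      then show "v \<in> lower_central G (initial_seg s i)"
        using finite_seg lcs_lower_central_finite[of "initial_seg s i"] assms(2) Well_order_Restr[OF W]
        unfolding initial_seg_def by blast
    qed
  qed
qed

lemma lower_central_omega_plus_one:
  assumes "s \<le>o omega_plus_one" "\<And>n. w \<in> lcs n" "t \<in> carrier G"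
  shows "w \<otimes> t \<otimes> inv w \<otimes> inv t \<in> lower_central G s"
proof -
  have W: "Well_order s" using ordLeq_Well_order_simp[OF assms(1)] by (rule conjunct1)
  let ?u = "w \<otimes> t \<otimes> inv w \<otimes> inv t"
  have seg: "initial_seg s i \<le>o natLeq" if "i \<in> Field s" for i
    using ordLess_ordLeq_trans[OF initial_seg_ordLess[OF W that] assms(1)] by (rule ordLess_omega_plus_one)
  have w: "w \<in> carrier G" using assms(2)[of 0] by simp
  have u: "?u \<in> lcs n" for n
  proof (cases n)
    case 0
    then show ?thesis using w assms(3) by simp
  next
    case (Suc k)
    then show ?thesis using commutator_in_lcs[OF assms(2)[of k] assms(3)] by simp
  qed
  show ?thesis
    using W
  proof (cases rule: lower_central_cases)
    case small
    then show ?thesis using w assms(3) by simp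
  next
    case (last m)
    have "w \<in> lower_central G (initial_seg s m)"
      using last(1) seg[of m] assms(2) by (intro lower_central_omega) (simp_all add: is_last_def)
    then show ?thesis
      unfolding last(2) commutator_subgroup_def using assms(3) by (intro generate.incl) blast
  next
    case limit
    then show ?thesis using lower_central_omega[OF seg u] by auto
  qed
qed

end

section \<open>Lifting crossed homomorphisms to the 2-adic integers\<close>

lemma of_int_bit_eq_0_iff: "(of_int k :: bit) = 0 \<longleftrightarrow> even k"
proof (cases "even k")
  case True
  then obtain j where "k = 2 * j" by (rule evenE)
  then show ?thesis by simp
next
  case False
  then obtain j where "k = 2 * j + 1" by (rule oddE)
  then show ?thesis by simp
qed

text \<open>
  The analogue of \<open>HZ_map_trivializes_cocycle\<close> for coefficients \<open>\<int>/2\<^sup>n\<close> on which \<open>E\<close> acts through the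
  signs \<open>\<sigma>\<close>. Modulo \<open>2\<close> the action is trivial. Hence a solution \<open>p\<close> modulo \<open>2\<^sup>n\<close> can be corrected to
  one modulo \<open>2\<^bsup>n+1\<^esup>\<close>: its error, divided by \<open>2\<^sup>n\<close>, is an untwisted cocycle modulo \<open>2\<close> that
  becomes a coboundary on \<open>G\<close>.
\<close>

proposition HZ_map_twisted_two_adic_lift:
  fixes f :: "'c \<Rightarrow> 'c \<Rightarrow> int" and \<sigma> :: "'c \<Rightarrow> int" and e :: "'a \<Rightarrow> int"
  assumes HZ: "HZ_map G E \<eta>"
    and \<sigma>: "\<And>g. g \<in> carrier E \<Longrightarrow> \<sigma> g = 1 \<or> \<sigma> g = -1"
    and \<sigma>_mult: "\<And>g h. \<lbrakk>g \<in> carrier E; h \<in> carrier E\<rbrakk> \<Longrightarrow> \<sigma> (g \<otimes>\<^bsub>E\<^esub> h) = \<sigma> g * \<sigma> h"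
    and cocycle: "\<And>g h l. \<lbrakk>g \<in> carrier E; h \<in> carrier E; l \<in> carrier E\<rbrakk> \<Longrightarrow>
        2 ^ n dvd f g h + f (g \<otimes>\<^bsub>E\<^esub> h) l - \<sigma> g * f h l - f g (h \<otimes>\<^bsub>E\<^esub> l)"
    and e: "\<And>g h. \<lbrakk>g \<in> carrier G; h \<in> carrier G\<rbrakk> \<Longrightarrow>
        2 ^ n dvd f (\<eta> g) (\<eta> h) - (e (g \<otimes>\<^bsub>G\<^esub> h) - e g - \<sigma> (\<eta> g) * e h)"
  shows "\<exists>p. (\<forall>g\<in>carrier E. \<forall>h\<in>carrier E.
            2 ^ n dvd p (g \<otimes>\<^bsub>E\<^esub> h) - p g - \<sigma> g * p h - f g h) \<and>
         (\<forall>g\<in>carrier G. 2 ^ n dvd e g - p (\<eta> g))"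
  using cocycle e
proof (induction n)
  case (Suc n)
  interpret G: group G using HZ by (simp add: HZ_map_iff)
  interpret E: group E using HZ by (simp add: HZ_map_iff)
  have \<eta>: "\<eta> \<in> hom G E" using HZ by (simp add: HZ_map_iff)
  have \<eta>c: "\<eta> g \<in> carrier E" if "g \<in> carrier G" for g
    using \<eta> that by (auto simp: hom_def)
  have weaken: "2 ^ n dvd x" if "2 ^ Suc n dvd x" for x :: int
    using that by (rule dvd_trans[rotated]) simp
  obtain p where p: "\<And>g h. \<lbrakk>g \<in> carrier E; h \<in> carrier E\<rbrakk> \<Longrightarrow>
        2 ^ n dvd p (g \<otimes>\<^bsub>E\<^esub> h) - p g - \<sigma> g * p h - f g h"
      "\<And>g. g \<in> carrier G \<Longrightarrow> 2 ^ n dvd e g - p (\<eta> g)"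
  proof -
    have "\<exists>p. (\<forall>g\<in>carrier E. \<forall>h\<in>carrier E.
            2 ^ n dvd p (g \<otimes>\<^bsub>E\<^esub> h) - p g - \<sigma> g * p h - f g h) \<and>
         (\<forall>g\<in>carrier G. 2 ^ n dvd e g - p (\<eta> g))"
      using Suc.prems by (intro Suc.IH weaken)
    then show thesis using that by blast
  qed
  define r where "r g h = p (g \<otimes>\<^bsub>E\<^esub> h) - p g - \<sigma> g * p h - f g h" for g h
  \<comment> \<open>the defect of \<open>p\<close> modulo \<open>2 ^ Suc n\<close>; its reduction modulo \<open>2\<close> is a cocycle\<close>
  define c where "c g h = r g h div 2 ^ n" for g h
  define e' where "e' g = (e g - p (\<eta> g)) div 2 ^ n" for g
  have r: "r g h = 2 ^ n * c g h" if "g \<in> carrier E" "h \<in> carrier E" for g h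
    using p(1)[OF that] by (simp add: c_def r_def)
  have e': "e g = p (\<eta> g) + 2 ^ n * e' g" if "g \<in> carrier G" for g
    using p(2)[OF that] by (simp add: e'_def)
  have halve: "even x" if "2 ^ Suc n dvd 2 ^ n * x" for x :: int
    using that by simp
  have \<sigma>_odd: "of_int (\<sigma> g) = (1 :: bit)" if "g \<in> carrier E" for g
    using \<sigma>[OF that] by auto
  have bit_cocycle: "of_int (c g h) + of_int (c (g \<otimes>\<^bsub>E\<^esub> h) l) =
        (of_int (c h l) + of_int (c g (h \<otimes>\<^bsub>E\<^esub> l)) :: bit)"
    if g: "g \<in> carrier E" and h: "h \<in> carrier E" and l: "l \<in> carrier E" for g h l
  proof -
    have "r g h + r (g \<otimes>\<^bsub>E\<^esub> h) l - \<sigma> g * r h l - r g (h \<otimes>\<^bsub>E\<^esub> l) =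
        - (f g h + f (g \<otimes>\<^bsub>E\<^esub> h) l - \<sigma> g * f h l - f g (h \<otimes>\<^bsub>E\<^esub> l))"
      using g h l by (simp add: r_def \<sigma>_mult E.m_assoc algebra_simps)
    then have "2 ^ Suc n dvd r g h + r (g \<otimes>\<^bsub>E\<^esub> h) l - \<sigma> g * r h l - r g (h \<otimes>\<^bsub>E\<^esub> l)"
      using Suc.prems(1)[OF g h l] by (simp only: dvd_minus_iff)
    also have "r g h + r (g \<otimes>\<^bsub>E\<^esub> h) l - \<sigma> g * r h l - r g (h \<otimes>\<^bsub>E\<^esub> l) =
        2 ^ n * (c g h + c (g \<otimes>\<^bsub>E\<^esub> h) l - \<sigma> g * c h l - c g (h \<otimes>\<^bsub>E\<^esub> l))"
      using g h l by (simp add: r algebra_simps)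
    finally have "of_int (c g h + c (g \<otimes>\<^bsub>E\<^esub> h) l - \<sigma> g * c h l - c g (h \<otimes>\<^bsub>E\<^esub> l)) = (0 :: bit)"
      unfolding of_int_bit_eq_0_iff by (rule halve)
    then show ?thesis
      by (simp only: of_int_add of_int_diff of_int_mult \<sigma>_odd[OF g] mult_1_left diff_diff_eq right_minus_eq)
  qed
  have bit_e: "of_int (c (\<eta> g) (\<eta> h)) = (of_int (e' g) + of_int (e' h) - of_int (e' (g \<otimes>\<^bsub>G\<^esub> h)) :: bit)"
    if g: "g \<in> carrier G" and h: "h \<in> carrier G" for g h
  proof -
    have "r (\<eta> g) (\<eta> h) - 2 ^ n * (e' g + \<sigma> (\<eta> g) * e' h - e' (g \<otimes>\<^bsub>G\<^esub> h)) =
        - (f (\<eta> g) (\<eta> h) - (e (g \<otimes>\<^bsub>G\<^esub> h) - e g - \<sigma> (\<eta> g) * e h))"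
      using g h e' hom_mult[OF \<eta> g h] by (simp add: r_def algebra_simps)
    then have "2 ^ Suc n dvd r (\<eta> g) (\<eta> h) - 2 ^ n * (e' g + \<sigma> (\<eta> g) * e' h - e' (g \<otimes>\<^bsub>G\<^esub> h))"
      using Suc.prems(2)[OF g h] by (simp only: dvd_minus_iff)
    also have "r (\<eta> g) (\<eta> h) - 2 ^ n * (e' g + \<sigma> (\<eta> g) * e' h - e' (g \<otimes>\<^bsub>G\<^esub> h)) =
        2 ^ n * (c (\<eta> g) (\<eta> h) - (e' g + \<sigma> (\<eta> g) * e' h - e' (g \<otimes>\<^bsub>G\<^esub> h)))"
      using g h by (simp add: r \<eta>c algebra_simps)
    finally have "of_int (c (\<eta> g) (\<eta> h) - (e' g + \<sigma> (\<eta> g) * e' h - e' (g \<otimes>\<^bsub>G\<^esub> h))) = (0 :: bit)"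
      unfolding of_int_bit_eq_0_iff by (rule halve)
    then show ?thesis
      by (simp only: of_int_add of_int_diff of_int_mult \<sigma>_odd[OF \<eta>c[OF g]] mult_1_left right_minus_eq)
  qed
  obtain d where d: "\<And>g h. \<lbrakk>g \<in> carrier E; h \<in> carrier E\<rbrakk> \<Longrightarrow> of_int (c g h) = d g + d h - (d (g \<otimes>\<^bsub>E\<^esub> h) :: bit)"
    "\<And>g. g \<in> carrier G \<Longrightarrow> d (\<eta> g) = of_int (e' g)"
    using HZ_map_trivializes_cocycle[OF HZ, of "\<lambda>g h. of_int (c g h)" "\<lambda>g. of_int (e' g) :: bit", OF bit_cocycle bit_e]
    by blast
  define D where "D g = (if d g = 0 then 0 else 1 :: int)" for g
  have D: "of_int (D g) = d g" for g
    by (cases "d g") (simp_all add: D_def)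
  define p' where "p' g = p g + 2 ^ n * D g" for g
  have "2 ^ Suc n dvd p' (g \<otimes>\<^bsub>E\<^esub> h) - p' g - \<sigma> g * p' h - f g h"
    if g: "g \<in> carrier E" and h: "h \<in> carrier E" for g h
  proof -
    have "of_int (c g h + D (g \<otimes>\<^bsub>E\<^esub> h) - D g - \<sigma> g * D h) = (0 :: bit)"
      unfolding of_int_add of_int_diff of_int_mult d(1)[OF g h] D \<sigma>_odd[OF g]
      by (simp only: mult_1_left algebra_simps) simp
    then have "even (c g h + D (g \<otimes>\<^bsub>E\<^esub> h) - D g - \<sigma> g * D h)"
      by (simp only: of_int_bit_eq_0_iff)
    then have "2 ^ Suc n dvd 2 ^ n * (c g h + D (g \<otimes>\<^bsub>E\<^esub> h) - D g - \<sigma> g * D h)"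
      by simp
    also have "2 ^ n * (c g h + D (g \<otimes>\<^bsub>E\<^esub> h) - D g - \<sigma> g * D h) =
        p' (g \<otimes>\<^bsub>E\<^esub> h) - p' g - \<sigma> g * p' h - f g h"
      using r[OF g h] by (simp add: r_def p'_def algebra_simps)
    finally show ?thesis .
  qed
  moreover have "2 ^ Suc n dvd e g - p' (\<eta> g)" if g: "g \<in> carrier G" for g
  proof -
    have "of_int (e' g - D (\<eta> g)) = (0 :: bit)"
      using d(2)[OF g] by (simp add: D)
    then have "2 ^ Suc n dvd 2 ^ n * (e' g - D (\<eta> g))"
      by (simp add: of_int_bit_eq_0_iff del: of_int_diff)
    then show ?thesis by (simp add: p'_def e'[OF g] algebra_simps)
  qed
  ultimately show ?case by blast
qed auto

section \<open>Rational functionals on the 2-adic integers\<close>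

text \<open>
  Extend \<open>N\<close> to a maximal subgroup \<open>M\<close> that meets \<open>\<int>v\<close> only in \<open>0\<close>. By maximality, each \<open>x\<close> has a
  nonzero multiple in \<open>\<int>v + M\<close>, say \<open>n x \<equiv> m v\<close> modulo \<open>M\<close>, and \<open>\<mu> x = m / n\<close> is well defined.
\<close>

lemma ex_additive_functional:
  fixes v :: "'i \<Rightarrow> int" and N :: "('i \<Rightarrow> int) set"
  assumes N0: "(\<lambda>i. 0) \<in> N"
    and N_diff: "\<And>x y. x \<in> N \<Longrightarrow> y \<in> N \<Longrightarrow> (\<lambda>i. x i - y i) \<in> N"
    and v: "\<And>n. (\<lambda>i. n * v i) \<in> N \<Longrightarrow> n = 0"
  obtains \<mu> :: "('i \<Rightarrow> int) \<Rightarrow> rat"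
  where "\<And>x y. \<mu> (\<lambda>i. x i + y i) = \<mu> x + \<mu> y" "\<And>x. x \<in> N \<Longrightarrow> \<mu> x = 0" "\<mu> v = 1"
proof -
  define \<S> where "\<S> = {H. N \<subseteq> H \<and> (\<forall>x\<in>H. \<forall>y\<in>H. (\<lambda>i. x i - y i) \<in> H) \<and>
     (\<forall>n. (\<lambda>i. n * v i) \<in> H \<longrightarrow> n = 0)}"
  have "\<exists>M\<in>\<S>. \<forall>X\<in>\<S>. M \<subseteq> X \<longrightarrow> X = M"
  proof (rule subset_Zorn_nonempty)
    show "\<S> \<noteq> {}" using assms by (auto simp: \<S>_def)
  next
    fix \<C> assume \<C>: "\<C> \<noteq> {}" "subset.chain \<S> \<C>"
    have member: "A \<in> \<S>" if "A \<in> \<C>" for A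
      using \<C>(2) that unfolding subset.chain_def by blast
    have "(\<lambda>i. x i - y i) \<in> \<Union>\<C>" if xy: "x \<in> \<Union>\<C>" "y \<in> \<Union>\<C>" for x y
    proof -
      obtain A B where "x \<in> A" "A \<in> \<C>" "y \<in> B" "B \<in> \<C>" using xy by blast
      then obtain C where "C \<in> \<C>" "x \<in> C" "y \<in> C"
        using \<C>(2) unfolding subset.chain_def by blast
      then show ?thesis using member[of C] unfolding \<S>_def by blast
    qed
    moreover have "N \<subseteq> \<Union>\<C>"
      using \<C>(1) member unfolding \<S>_def by blast
    moreover have "n = 0" if "(\<lambda>i. n * v i) \<in> \<Union>\<C>" for n
      using member that unfolding \<S>_def by blast
    ultimately show "\<Union>\<C> \<in> \<S>"
      unfolding \<S>_def by blast
  qed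
  then obtain M where M: "M \<in> \<S>" and max: "\<And>X. X \<in> \<S> \<Longrightarrow> M \<subseteq> X \<Longrightarrow> X = M" by blast
  have M0: "(\<lambda>i. 0) \<in> M" and NM: "N \<subseteq> M" using M N0 by (auto simp: \<S>_def)
  have M_diff: "(\<lambda>i. x i - y i) \<in> M" if "x \<in> M" "y \<in> M" for x y
    using M that by (auto simp: \<S>_def)
  have M_v: "n = 0" if "(\<lambda>i. n * v i) \<in> M" for n
    using M that by (auto simp: \<S>_def)
  have M_minus: "(\<lambda>i. - x i) \<in> M" if "x \<in> M" for x
    using M_diff[OF M0 that] by simp
  have M_add: "(\<lambda>i. x i + y i) \<in> M" if "x \<in> M" "y \<in> M" for x y
    using M_diff[OF that(1) M_minus[OF that(2)]] by simp
  have M_mult_nat: "(\<lambda>i. int k * x i) \<in> M" if "x \<in> M" for k x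
  proof (induction k)
    case 0 then show ?case using M0 by simp
  next
    case (Suc k)
    then show ?case using M_add[OF that Suc] by (simp add: algebra_simps)
  qed
  have M_mult: "(\<lambda>i. k * x i) \<in> M" if "x \<in> M" for k x
  proof (cases "k \<ge> 0")
    case True
    then show ?thesis using M_mult_nat[OF that, of "nat k"] by simp
  next
    case False
    then show ?thesis using M_minus[OF M_mult_nat[OF that, of "nat (- k)"]] by simp
  qed
  have rank1: "\<exists>n m. n \<noteq> 0 \<and> (\<lambda>i. n * x i - m * v i) \<in> M" for x
  proof (cases "x \<in> M")
    case True
    then show ?thesis by (intro exI[of _ 1] exI[of _ 0]) simp
  next
    case False
    define H where "H = {(\<lambda>i. h i + k * x i) | h k. h \<in> M}"
    have MH: "M \<subseteq> H"
    proof
      fix h assume "h \<in> M"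
      then show "h \<in> H" unfolding H_def by (intro CollectI exI[of _ h] exI[of _ 0]) simp
    qed
    have "x \<in> H" unfolding H_def using M0 by (intro CollectI exI[of _ "\<lambda>i. 0"] exI[of _ 1]) simp
    then have "H \<notin> \<S>" using False max[OF _ MH] by blast
    moreover have "(\<lambda>i. y i - z i) \<in> H" if yz: "y \<in> H" "z \<in> H" for y z
    proof -
      obtain h k h' k' where "h \<in> M" "y = (\<lambda>i. h i + k * x i)" "h' \<in> M" "z = (\<lambda>i. h' i + k' * x i)"
        using yz by (auto simp: H_def)
      then show ?thesis
        unfolding H_def using M_diff[of h h']
        by (intro CollectI exI[of _ "\<lambda>i. h i - h' i"] exI[of _ "k - k'"]) (simp add: algebra_simps)
    qed
    ultimately obtain n where n: "(\<lambda>i. n * v i) \<in> H" "n \<noteq> 0"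
      using NM MH by (auto simp: \<S>_def)
    then obtain h k where h: "h \<in> M" "(\<lambda>i. n * v i) = (\<lambda>i. h i + k * x i)" by (auto simp: H_def)
    have "k \<noteq> 0" using M_v[of n] n h by auto
    moreover have "(\<lambda>i. k * x i - n * v i) = (\<lambda>i. - h i)"
      using fun_cong[OF h(2)] by simp
    ultimately show ?thesis using M_minus[OF h(1)] by metis
  qed
  have unique: "(of_int m / of_int n :: rat) = of_int m' / of_int n'"
    if nm: "n \<noteq> 0" "(\<lambda>i. n * x i - m * v i) \<in> M" "n' \<noteq> 0" "(\<lambda>i. n' * x i - m' * v i) \<in> M"
    for n m n' m' x
  proof -
    have "(\<lambda>i. n' * (n * x i - m * v i) - n * (n' * x i - m' * v i)) \<in> M"
      by (intro M_diff M_mult nm)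
    moreover have "(\<lambda>i. n' * (n * x i - m * v i) - n * (n' * x i - m' * v i)) = (\<lambda>i. (n * m' - n' * m) * v i)"
      by (simp add: algebra_simps)
    ultimately have "n * m' = n' * m" using M_v[of "n * m' - n' * m"] by simp
    then have "of_int n * of_int m' = (of_int n' * of_int m :: rat)"
      by (metis of_int_mult)
    then show ?thesis using nm by (simp add: field_simps)
  qed
  obtain n m where nm: "\<And>x. n x \<noteq> (0::int)" "\<And>x. (\<lambda>i. n x * x i - m x * v i) \<in> M"
    using rank1 by metis
  define \<mu> where "\<mu> x = (of_int (m x) / of_int (n x) :: rat)" for x
  have \<mu>: "\<mu> x = of_int m' / of_int n'" if "n' \<noteq> 0" "(\<lambda>i. n' * x i - m' * v i) \<in> M" for x n' m'
    unfolding \<mu>_def by (rule unique[OF nm that])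
  have "\<mu> (\<lambda>i. x i + y i) = \<mu> x + \<mu> y" for x y
  proof -
    have "(\<lambda>i. n y * (n x * x i - m x * v i) + n x * (n y * y i - m y * v i)) \<in> M"
      by (intro M_add M_mult nm)
    moreover have "(\<lambda>i. n y * (n x * x i - m x * v i) + n x * (n y * y i - m y * v i)) =
       (\<lambda>i. (n x * n y) * (x i + y i) - (n y * m x + n x * m y) * v i)"
      by (simp add: algebra_simps)
    ultimately have "\<mu> (\<lambda>i. x i + y i) = of_int (n y * m x + n x * m y) / of_int (n x * n y)"
      using nm(1) by (intro \<mu>) simp_all
    then show ?thesis using nm(1)[of x] nm(1)[of y] by (simp add: \<mu>_def field_simps)
  qed
  moreover have "\<mu> x = 0" if "x \<in> N" for x
    using \<mu>[of 1 x 0] that NM by auto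
  moreover have "\<mu> v = 1"
    using \<mu>[of 1 v 1] M0 by simp
  ultimately show thesis using that by blast
qed

text \<open>
  Approximations to the 2-adic integer \<open>\<theta>\<close> with \<open>\<theta> = 1 + 2\<theta>\<^sup>2\<close>. The discriminant of this equation is
  \<open>-7\<close>, so \<open>\<theta>\<close> is not rational; any irrational 2-adic integer would do, and this one makes irrationality
  a matter of a definite quadratic form.
\<close>

primrec theta :: "nat \<Rightarrow> int" where
  "theta 0 = 0"
| "theta (Suc n) = 1 + 2 * (theta n)\<^sup>2"

lemma theta_Suc_diff: "2 ^ n dvd theta (Suc n) - theta n"
proof (induction n)
  case (Suc n)
  have "theta (Suc (Suc n)) - theta (Suc n) = 2 * ((theta (Suc n) - theta n) * (theta (Suc n) + theta n))"
    by (simp only: theta.simps(2)[of "Suc n"] theta.simps(2)[of n]) (simp add: algebra_simps power2_eq_square)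
  then show ?case
    using Suc by (simp only: power_Suc) (intro mult_dvd_mono dvd_refl dvd_mult2)
qed simp

text \<open>
  If \<open>m + k\<theta> = 0\<close>, then \<open>2m\<^sup>2 + mk + k\<^sup>2 = k\<^sup>2 (2\<theta>\<^sup>2 - \<theta> + 1) = 0\<close>, and this form is positive definite.
\<close>

lemma theta_independent:
  assumes "\<And>n. 2 ^ n dvd m + k * theta n"
  shows "m = 0" "k = 0"
proof -
  let ?A = "2 * m\<^sup>2 + m * k + k\<^sup>2"
  have dvd: "2 ^ n dvd ?A" for n
  proof -
    have "?A = k\<^sup>2 * (theta (Suc n) - theta n) + (m + k * theta n) * (2 * m - 2 * k * theta n + k)"
      by (simp add: algebra_simps power2_eq_square)
    then show ?thesis
      using dvd_add[OF dvd_mult[OF theta_Suc_diff[of n]] dvd_mult2[OF assms[of n]]] by (simp only:)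
  qed
  have "?A = 0"
  proof (rule ccontr)
    assume "?A \<noteq> 0"
    then have "2 ^ nat \<bar>?A\<bar> \<le> \<bar>?A\<bar>"
      using dvd_imp_le_int[OF _ dvd[of "nat \<bar>?A\<bar>"]] by simp
    moreover have "int (nat \<bar>?A\<bar>) < int (2 ^ nat \<bar>?A\<bar>)"
      unfolding of_nat_less_iff by (rule less_exp)
    ultimately show False by simp
  qed
  moreover have "8 * ?A = (4 * m + k)\<^sup>2 + 7 * k\<^sup>2"
    by (simp add: algebra_simps power2_eq_square)
  ultimately have *: "(4 * m + k)\<^sup>2 + 7 * k\<^sup>2 = 0" by simp
  then have "k\<^sup>2 = 0" using zero_le_power2[of "4 * m + k"] zero_le_power2[of k] by linarith
  then show "k = 0" by simp
  then show "m = 0" using * by simp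
qed

text \<open>
  Here and below, a sequence of integers stands for the family of the residue classes of its \<open>n\<close>-th
  entry modulo \<open>2\<^sup>n\<close>. The constant sequence \<open>1\<close> and \<open>theta\<close> represent 2-adic integers, but the
  functionals are defined on all of \<open>\<Prod>\<^sub>n \<int>/2\<^sup>n\<close>, so that coherence of a sequence never has to be checked.
\<close>

lemma ex_dual_functionals:
  obtains \<mu> \<nu> :: "(nat \<Rightarrow> int) \<Rightarrow> rat"
  where "\<And>x y. \<mu> (\<lambda>i. x i + y i) = \<mu> x + \<mu> y" "\<And>x y. \<nu> (\<lambda>i. x i + y i) = \<nu> x + \<nu> y"
    "\<And>x. (\<And>n. 2 ^ n dvd x n) \<Longrightarrow> \<mu> x = 0" "\<And>x. (\<And>n. 2 ^ n dvd x n) \<Longrightarrow> \<nu> x = 0"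
    "\<mu> (\<lambda>i. 1) = 1" "\<mu> theta = 0" "\<nu> (\<lambda>i. 1) = 0" "\<nu> theta = 1"
proof -
  define N where "N w = {x :: nat \<Rightarrow> int. \<exists>k. \<forall>n. 2 ^ n dvd x n - k * w n}" for w
  have N: "(\<lambda>i. 0) \<in> N w" "w \<in> N w" "(\<And>n. 2 ^ n dvd x n) \<Longrightarrow> x \<in> N w"
    "x \<in> N w \<Longrightarrow> y \<in> N w \<Longrightarrow> (\<lambda>i. x i - y i) \<in> N w" for w x y
  proof -
    show "(\<lambda>i. 0) \<in> N w" by (auto simp: N_def intro: exI[of _ 0])
    show "w \<in> N w" by (auto simp: N_def intro: exI[of _ 1])
    show "x \<in> N w" if "\<And>n. 2 ^ n dvd x n"
      using that by (auto simp: N_def intro!: exI[of _ 0])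
    assume "x \<in> N w" "y \<in> N w"
    then obtain k l where "\<And>n. 2 ^ n dvd x n - k * w n" "\<And>n. 2 ^ n dvd y n - l * w n"
      by (auto simp: N_def)
    then have "2 ^ n dvd (x n - k * w n) - (y n - l * w n)" for n
      using dvd_diff by blast
    moreover have "(x n - k * w n) - (y n - l * w n) = (x n - y n) - (k - l) * w n" for n
      by (simp add: algebra_simps)
    ultimately show "(\<lambda>i. x i - y i) \<in> N w"
      unfolding N_def by (intro CollectI exI[of _ "k - l"]) simp
  qed
  have theta: "n = 0" if "(\<lambda>i. n * theta i) \<in> N (\<lambda>i. 1)" for n
    using that theta_independent(2)[of "- _" n] by (auto simp: N_def)
  obtain \<nu> :: "(nat \<Rightarrow> int) \<Rightarrow> rat" where \<nu>: "\<And>x y. \<nu> (\<lambda>i. x i + y i) = \<nu> x + \<nu> y"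
    "\<And>x. x \<in> N (\<lambda>i. 1) \<Longrightarrow> \<nu> x = 0" "\<nu> theta = 1"
    using ex_additive_functional[of "N (\<lambda>i. 1)" theta, OF N(1) N(4) theta] by blast
  have one: "n = 0" if "(\<lambda>i. n * 1) \<in> N theta" for n
    using that theta_independent(1)[of n "- _"] by (auto simp: N_def)
  obtain \<mu> :: "(nat \<Rightarrow> int) \<Rightarrow> rat" where \<mu>: "\<And>x y. \<mu> (\<lambda>i. x i + y i) = \<mu> x + \<mu> y"
    "\<And>x. x \<in> N theta \<Longrightarrow> \<mu> x = 0" "\<mu> (\<lambda>i. 1) = 1"
    using ex_additive_functional[of "N theta" "\<lambda>i. 1", OF N(1) N(4) one] by blast
  show thesis
    by (rule that[of \<mu> \<nu>]) (use \<mu> \<nu> N in auto)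
qed

section \<open>Coordinates on the localization\<close>

definition parity_sign :: "int \<Rightarrow> int" where
  "parity_sign i = (if even i then 1 else -1)"

lemma parity_sign_simps [simp]:
  "parity_sign 0 = 1" "parity_sign 1 = -1"
  "parity_sign (i + j) = parity_sign i * parity_sign j"
  "parity_sign i * parity_sign i = 1"
  by (auto simp: parity_sign_def)

lemma parity_sign_cases: "parity_sign i = 1 \<or> parity_sign i = -1"
  by (simp add: parity_sign_def)

lemma action_matrix_component:
  "(action_matrix *v v) $ 1 = - v $ 1 + v $ 2" "(action_matrix *v v) $ 2 = - v $ 2"
  by (simp_all add: action_matrix_def matrix_vector_mult_def sum_2)

text \<open>
  The matrix is \<open>-(1 - N)\<close> with \<open>N\<close> nilpotent, so its \<open>i\<close>-th power is \<open>(-1)\<^sup>i (1 - i N)\<close>, also for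
  negative \<open>i\<close>.
\<close>

lemma int_funpow_action_matrix:
  "int_funpow (\<lambda>v. action_matrix *v v) i v $ 1 = parity_sign i * (v $ 1 - i * v $ 2)"
  "int_funpow (\<lambda>v. action_matrix *v v) i v $ 2 = parity_sign i * v $ 2"
proof -
  let ?\<theta> = "\<lambda>v :: int ^ 2. action_matrix *v v"
  define \<theta>' :: "int ^ 2 \<Rightarrow> int ^ 2" where "\<theta>' v = (vector [- v $ 1 - v $ 2, - v $ 2] :: int ^ 2)" for v
  have inv: "inv_into UNIV ?\<theta> = \<theta>'"
    by (rule inv_equality) (simp_all add: vec_eq_iff forall_2 action_matrix_component \<theta>'_def)
  have pow: "(?\<theta> ^^ n) v $ 1 = parity_sign (int n) * (v $ 1 - int n * v $ 2) \<and>
      (?\<theta> ^^ n) v $ 2 = parity_sign (int n) * v $ 2" for n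
    by (induction n) (simp_all add: action_matrix_component algebra_simps)
  have pow': "(\<theta>' ^^ n) v $ 1 = parity_sign (int n) * (v $ 1 + int n * v $ 2) \<and>
      (\<theta>' ^^ n) v $ 2 = parity_sign (int n) * v $ 2" for n
    by (induction n) (simp_all add: \<theta>'_def algebra_simps)
  have "parity_sign (- i) = parity_sign i" by (simp add: parity_sign_def)
  then show "int_funpow ?\<theta> i v $ 1 = parity_sign i * (v $ 1 - i * v $ 2)"
    "int_funpow ?\<theta> i v $ 2 = parity_sign i * v $ 2"
    using pow[of "nat i"] pow'[of "nat (- i)"] by (auto simp: int_funpow_def inv)
qed

lemma carrier_MC [simp]: "carrier MC = UNIV"
  by (simp add: MC_def semidirect_cyclic_def)

lemma mult_MC:
  "fst (g \<otimes>\<^bsub>MC\<^esub> h) $ 1 = fst g $ 1 + parity_sign (snd g) * (fst h $ 1 - snd g * fst h $ 2)"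
  "fst (g \<otimes>\<^bsub>MC\<^esub> h) $ 2 = fst g $ 2 + parity_sign (snd g) * fst h $ 2"
  "snd (g \<otimes>\<^bsub>MC\<^esub> h) = snd g + snd h"
  by (simp_all add: MC_def semidirect_cyclic_def case_prod_beta int_funpow_action_matrix)

lemma MC_eqI: "fst g $ 1 = fst h $ 1 \<Longrightarrow> fst g $ 2 = fst h $ 2 \<Longrightarrow> snd g = snd h \<Longrightarrow> g = (h :: (int ^ 2) \<times> int)"
  by (simp add: prod_eq_iff vec_eq_iff forall_2)

definition MC_b :: "int \<Rightarrow> (int ^ 2) \<times> int" where
  "MC_b c = (vector [0, c], 0)"

definition MC_t :: "(int ^ 2) \<times> int" where
  "MC_t = (0, 1)"

lemma MC_simps [simp]:
  "fst (MC_b c) $ 1 = 0" "fst (MC_b c) $ 2 = c" "snd (MC_b c) = 0" "fst MC_t = 0" "snd MC_t = 1"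
  by (simp_all add: MC_b_def MC_t_def)

lemma additive_of_int_mult:
  fixes \<mu> :: "('i \<Rightarrow> int) \<Rightarrow> rat"
  assumes add: "\<And>x y. \<mu> (\<lambda>i. x i + y i) = \<mu> x + \<mu> y"
  shows "\<mu> (\<lambda>i. k * x i) = of_int k * \<mu> x"
proof -
  have 0: "\<mu> (\<lambda>i. 0) = 0" using add[of "\<lambda>i. 0" "\<lambda>i. 0"] by simp
  have minus: "\<mu> (\<lambda>i. - y i) = - \<mu> y" for y
    using add[of y "\<lambda>i. - y i"] 0 by simp
  have nat: "\<mu> (\<lambda>i. int n * x i) = of_nat n * \<mu> x" for n
  proof (induction n)
    case (Suc n)
    have "\<mu> (\<lambda>i. int (Suc n) * x i) = \<mu> (\<lambda>i. x i + int n * x i)" by (simp add: algebra_simps)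
    also have "\<dots> = \<mu> x + of_nat n * \<mu> x" by (simp only: add Suc)
    finally show ?case by (simp add: algebra_simps)
  qed (simp add: 0)
  show ?thesis
  proof (cases "k \<ge> 0")
    case True
    then show ?thesis using nat[of "nat k"] by simp
  next
    case False
    then show ?thesis using minus[of "\<lambda>i. int (nat (- k)) * x i"] nat[of "nat (- k)"] by simp
  qed
qed

lemma additive_congruent:
  fixes \<mu> :: "(nat \<Rightarrow> int) \<Rightarrow> rat"
  assumes add: "\<And>x y. \<mu> (\<lambda>i. x i + y i) = \<mu> x + \<mu> y"
    and null: "\<And>x. (\<And>n. 2 ^ n dvd x n) \<Longrightarrow> \<mu> x = 0"
    and "\<And>n. 2 ^ n dvd x n - y n"
  shows "\<mu> x = \<mu> y"
proof -
  have "\<mu> (\<lambda>i. (x i - y i) + y i) = \<mu> (\<lambda>i. x i - y i) + \<mu> y" by (rule add)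
  then show ?thesis using null[of "\<lambda>i. x i - y i"] assms(3) by simp
qed

text \<open>
  The coordinates of \<open>M \<rtimes> C\<close> extend to \<open>E\<close>, those of \<open>M\<close> after passing to the 2-adic integers. The
  homomorphism \<open>k\<close> and the crossed homomorphism \<open>q\<close> come from the zero cocycle; the extension
  of the first coordinate is a cochain that bounds the twisted product of \<open>k\<close> and \<open>q\<close>.
\<close>

proposition HZ_map_MC_crossed_homs:
  assumes HZ: "HZ_map MC E \<eta>"
  obtains k :: "'e \<Rightarrow> int" and q p :: "nat \<Rightarrow> 'e \<Rightarrow> int" where
    "\<And>g h. g \<in> carrier E \<Longrightarrow> h \<in> carrier E \<Longrightarrow> k (g \<otimes>\<^bsub>E\<^esub> h) = k g + k h"
    "\<And>g. k (\<eta> g) = snd g"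
    "\<And>n g h. g \<in> carrier E \<Longrightarrow> h \<in> carrier E \<Longrightarrow>
       2 ^ n dvd q n (g \<otimes>\<^bsub>E\<^esub> h) - q n g - parity_sign (k g) * q n h"
    "\<And>n g. 2 ^ n dvd fst g $ 2 - q n (\<eta> g)"
    "\<And>n g h. g \<in> carrier E \<Longrightarrow> h \<in> carrier E \<Longrightarrow>
       2 ^ n dvd p n (g \<otimes>\<^bsub>E\<^esub> h) - p n g - parity_sign (k g) * (p n h - k g * q n h)"
    "\<And>n g. 2 ^ n dvd fst g $ 1 - p n (\<eta> g)"
proof -
  interpret E: group E using HZ by (simp add: HZ_map_iff)
  have \<eta>: "\<eta> \<in> hom MC E" using HZ by (simp add: HZ_map_iff)
  have \<eta>c: "\<eta> g \<in> carrier E" for g using \<eta> by (auto simp: hom_def)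
  obtain k :: "'e \<Rightarrow> int" where k0: "\<And>g h. g \<in> carrier E \<Longrightarrow> h \<in> carrier E \<Longrightarrow> 0 = k g + k h - k (g \<otimes>\<^bsub>E\<^esub> h)"
    and k\<eta>: "\<And>g. k (\<eta> g) = snd g"
    using HZ_map_trivializes_cocycle[OF HZ, of "\<lambda>_ _. 0" snd] by (auto simp: mult_MC)
  have k: "k (g \<otimes>\<^bsub>E\<^esub> h) = k g + k h" if "g \<in> carrier E" "h \<in> carrier E" for g h
    using k0[OF that] by simp
  let ?\<sigma> = "\<lambda>g. parity_sign (k g)"
  have "\<exists>q. (\<forall>g\<in>carrier E. \<forall>h\<in>carrier E. 2 ^ n dvd q (g \<otimes>\<^bsub>E\<^esub> h) - q g - ?\<sigma> g * q h - 0) \<and>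
      (\<forall>g\<in>carrier MC. 2 ^ n dvd fst g $ 2 - q (\<eta> g))" for n
    by (rule HZ_map_twisted_two_adic_lift[OF HZ])
       (simp_all add: parity_sign_cases k k\<eta> mult_MC)
  then have "\<exists>q. (\<forall>g\<in>carrier E. \<forall>h\<in>carrier E. 2 ^ n dvd q (g \<otimes>\<^bsub>E\<^esub> h) - q g - ?\<sigma> g * q h) \<and>
      (\<forall>g. 2 ^ n dvd fst g $ 2 - q (\<eta> g))" for n
    by simp
  then obtain q where q: "\<And>n g h. g \<in> carrier E \<Longrightarrow> h \<in> carrier E \<Longrightarrow>
       2 ^ n dvd q n (g \<otimes>\<^bsub>E\<^esub> h) - q n g - ?\<sigma> g * q n h"
    and q\<eta>: "\<And>n g. 2 ^ n dvd fst g $ 2 - q n (\<eta> g)"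
    by metis
  let ?f = "\<lambda>n g h. - (?\<sigma> g * k g * q n h)"
  have "\<exists>p. (\<forall>g\<in>carrier E. \<forall>h\<in>carrier E. 2 ^ n dvd p (g \<otimes>\<^bsub>E\<^esub> h) - p g - ?\<sigma> g * p h - ?f n g h) \<and>
      (\<forall>g\<in>carrier MC. 2 ^ n dvd fst g $ 1 - p (\<eta> g))" for n
  proof (rule HZ_map_twisted_two_adic_lift[OF HZ])
    fix g h l assume g: "g \<in> carrier E" and h: "h \<in> carrier E" and l: "l \<in> carrier E"
    have "?f n g h + ?f n (g \<otimes>\<^bsub>E\<^esub> h) l - ?\<sigma> g * ?f n h l - ?f n g (h \<otimes>\<^bsub>E\<^esub> l) =
        ?\<sigma> g * k g * (q n (h \<otimes>\<^bsub>E\<^esub> l) - q n h - ?\<sigma> h * q n l)"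
      using g h by (simp add: k algebra_simps)
    then show "2 ^ n dvd ?f n g h + ?f n (g \<otimes>\<^bsub>E\<^esub> h) l - ?\<sigma> g * ?f n h l - ?f n g (h \<otimes>\<^bsub>E\<^esub> l)"
      using q[OF h l] by simp
  next
    fix g h
    have "?f n (\<eta> g) (\<eta> h) - (fst (g \<otimes>\<^bsub>MC\<^esub> h) $ 1 - fst g $ 1 - ?\<sigma> (\<eta> g) * fst h $ 1) =
       parity_sign (snd g) * snd g * (fst h $ 2 - q n (\<eta> h))"
      by (simp add: k\<eta> mult_MC algebra_simps)
    then show "2 ^ n dvd ?f n (\<eta> g) (\<eta> h) - (fst (g \<otimes>\<^bsub>MC\<^esub> h) $ 1 - fst g $ 1 - ?\<sigma> (\<eta> g) * fst h $ 1)"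
      using q\<eta>[of n h] by simp
  qed (simp_all add: parity_sign_cases k)
  then have "\<exists>p. (\<forall>g\<in>carrier E. \<forall>h\<in>carrier E. 2 ^ n dvd p (g \<otimes>\<^bsub>E\<^esub> h) - p g - ?\<sigma> g * (p h - k g * q n h)) \<and>
      (\<forall>g. 2 ^ n dvd fst g $ 1 - p (\<eta> g))" for n
    by (simp add: algebra_simps del: split_paired_All)
  then obtain p where p: "\<And>n g h. g \<in> carrier E \<Longrightarrow> h \<in> carrier E \<Longrightarrow>
       2 ^ n dvd p n (g \<otimes>\<^bsub>E\<^esub> h) - p n g - ?\<sigma> g * (p n h - k g * q n h)"
    and p\<eta>: "\<And>n g. 2 ^ n dvd fst g $ 1 - p n (\<eta> g)"
    by metis
  show thesis
    by (rule that[OF k k\<eta> q q\<eta> p p\<eta>])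
qed

section \<open>A Massey product\<close>

text \<open>
  The function \<open>f\<close> bounds the cup product of \<open>a\<close> and \<open>b\<close>, and \<open>P\<close> bounds that of \<open>k\<close> and \<open>a\<close>, up to
  sign. The terms by which \<open>f'\<close> fails to be additive form the cocycle that represents the
  Massey product of \<open>k\<close>, \<open>a\<close> and \<open>b\<close>. Both cocycles vanish on \<open>G\<close>, because \<open>b\<close> does and \<open>f\<close> is chosen
  to do so.
\<close>

proposition HZ_map_trivializes_massey_product:
  fixes k :: "'e \<Rightarrow> int" and a b P :: "'e \<Rightarrow> rat"
  defines "\<sigma> g \<equiv> of_int (parity_sign (k g)) :: rat"
  assumes HZ: "HZ_map G E \<eta>"
    and k: "\<And>g h. g \<in> carrier E \<Longrightarrow> h \<in> carrier E \<Longrightarrow> k (g \<otimes>\<^bsub>E\<^esub> h) = k g + k h"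
    and a: "\<And>g h. g \<in> carrier E \<Longrightarrow> h \<in> carrier E \<Longrightarrow> a (g \<otimes>\<^bsub>E\<^esub> h) = a g + \<sigma> g * a h"
    and b: "\<And>g h. g \<in> carrier E \<Longrightarrow> h \<in> carrier E \<Longrightarrow> b (g \<otimes>\<^bsub>E\<^esub> h) = b g + \<sigma> g * b h"
    and P: "\<And>g h. g \<in> carrier E \<Longrightarrow> h \<in> carrier E \<Longrightarrow>
        P (g \<otimes>\<^bsub>E\<^esub> h) = P g + \<sigma> g * (P h - of_int (k g) * a h)"
    and b\<eta>: "\<And>g. g \<in> carrier G \<Longrightarrow> b (\<eta> g) = 0"
  obtains f f' :: "'e \<Rightarrow> rat" where
    "\<And>g h. g \<in> carrier E \<Longrightarrow> h \<in> carrier E \<Longrightarrow> f (g \<otimes>\<^bsub>E\<^esub> h) = f g + f h + \<sigma> g * a g * b h"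
    "\<And>g h. g \<in> carrier E \<Longrightarrow> h \<in> carrier E \<Longrightarrow>
       f' (g \<otimes>\<^bsub>E\<^esub> h) = f' g + f' h + of_int (k g) * f h - \<sigma> g * P g * b h"
proof -
  interpret E: group E using HZ by (simp add: HZ_map_iff)
  have \<eta>: "\<eta> \<in> hom G E" using HZ by (simp add: HZ_map_iff)
  have \<eta>c: "\<eta> g \<in> carrier E" if "g \<in> carrier G" for g using \<eta> that by (auto simp: hom_def)
  have \<sigma>: "\<sigma> (g \<otimes>\<^bsub>E\<^esub> h) = \<sigma> g * \<sigma> h" if "g \<in> carrier E" "h \<in> carrier E" for g h
    using that by (simp add: \<sigma>_def k)
  have \<sigma>1: "\<sigma> g * \<sigma> g = 1" for g
    unfolding \<sigma>_def of_int_mult[symmetric] by simp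
  have \<sigma>11: "\<sigma> g * (\<sigma> g * x) = x" for g x
    using \<sigma>1[of g] by (simp flip: mult.assoc)
  obtain d where d: "\<And>g h. g \<in> carrier E \<Longrightarrow> h \<in> carrier E \<Longrightarrow> \<sigma> g * a g * b h = d g + d h - d (g \<otimes>\<^bsub>E\<^esub> h)"
    and d\<eta>: "\<And>g. g \<in> carrier G \<Longrightarrow> d (\<eta> g) = 0"
  proof (rule HZ_map_trivializes_cocycle[OF HZ, of "\<lambda>g h. \<sigma> g * a g * b h" "\<lambda>_. 0"])
    fix g h l assume "g \<in> carrier E" "h \<in> carrier E" "l \<in> carrier E"
    then show "\<sigma> g * a g * b h + \<sigma> (g \<otimes>\<^bsub>E\<^esub> h) * a (g \<otimes>\<^bsub>E\<^esub> h) * b l =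
        \<sigma> h * a h * b l + \<sigma> g * a g * b (h \<otimes>\<^bsub>E\<^esub> l)"
      by (simp add: \<sigma> a b algebra_simps \<sigma>11)
  qed (use b\<eta> in auto)
  define f where "f g = - d g" for g
  have f: "f (g \<otimes>\<^bsub>E\<^esub> h) = f g + f h + \<sigma> g * a g * b h" if "g \<in> carrier E" "h \<in> carrier E" for g h
    using d[OF that] by (simp add: f_def)
  have f\<eta>: "f (\<eta> g) = 0" if "g \<in> carrier G" for g
    using d\<eta>[OF that] by (simp add: f_def)
  obtain d' where d': "\<And>g h. g \<in> carrier E \<Longrightarrow> h \<in> carrier E \<Longrightarrow>
      of_int (k g) * f h - \<sigma> g * P g * b h = d' g + d' h - d' (g \<otimes>\<^bsub>E\<^esub> h)"
    and "\<And>g. g \<in> carrier G \<Longrightarrow> d' (\<eta> g) = 0"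
  proof (rule HZ_map_trivializes_cocycle[OF HZ, of "\<lambda>g h. of_int (k g) * f h - \<sigma> g * P g * b h" "\<lambda>_. 0"])
    fix g h l assume "g \<in> carrier E" "h \<in> carrier E" "l \<in> carrier E"
    then show "of_int (k g) * f h - \<sigma> g * P g * b h +
          (of_int (k (g \<otimes>\<^bsub>E\<^esub> h)) * f l - \<sigma> (g \<otimes>\<^bsub>E\<^esub> h) * P (g \<otimes>\<^bsub>E\<^esub> h) * b l) =
        of_int (k h) * f l - \<sigma> h * P h * b l +
          (of_int (k g) * f (h \<otimes>\<^bsub>E\<^esub> l) - \<sigma> g * P g * b (h \<otimes>\<^bsub>E\<^esub> l))"
      by (simp add: \<sigma> k P b f algebra_simps \<sigma>11)
  qed (use b\<eta> f\<eta> in auto)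
  define f' where "f' g = - d' g" for g
  have "f' (g \<otimes>\<^bsub>E\<^esub> h) = f' g + f' h + of_int (k g) * f h - \<sigma> g * P g * b h"
    if "g \<in> carrier E" "h \<in> carrier E" for g h
    using d'[OF that] by (simp add: f'_def)
  with f show thesis using that by blast
qed

lemma (in group) commutator_swap:
  assumes "a \<in> carrier G" "b \<in> carrier G"
  shows "commutator a b \<otimes> (b \<otimes> a) = a \<otimes> b"
proof -
  have "inv b \<otimes> (b \<otimes> a) = a" "inv a \<otimes> a = \<one>"
    using assms by (simp_all flip: m_assoc)
  then show ?thesis using assms by (simp add: m_assoc)
qed

lemma (in group) commutator_mult_left:
  assumes "u \<in> carrier G" "z \<in> carrier G" "t \<in> carrier G"
  shows "commutator (u \<otimes> z) t = u \<otimes> commutator z t \<otimes> inv u \<otimes> commutator u t"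
proof -
  have "inv u \<otimes> (u \<otimes> (t \<otimes> inv u \<otimes> inv t)) = t \<otimes> inv u \<otimes> inv t"
    "inv t \<otimes> (t \<otimes> (inv u \<otimes> inv t)) = inv u \<otimes> inv t"
    using assms by (simp_all flip: m_assoc)
  then show ?thesis
    using assms by (simp add: m_assoc inv_mult_group)
qed

text \<open>
  The functions \<open>f\<close> and \<open>f'\<close> of \<open>HZ_map_trivializes_massey_product\<close>, for \<open>a = \<mu> q\<close>, \<open>b = \<nu> q\<close> and
  \<open>P = \<mu> p\<close>, play the role of matrix entries in a unipotent representation: \<open>f\<close> detects the first
  commutator, and \<open>f'\<close> the second one.
\<close>

proposition HZ_map_MC_commutator_detection:
  assumes HZ: "HZ_map MC E \<eta>"
  obtains k :: "'e \<Rightarrow> int" and q :: "nat \<Rightarrow> 'e \<Rightarrow> int" where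
    "\<And>g h. g \<in> carrier E \<Longrightarrow> h \<in> carrier E \<Longrightarrow> k (g \<otimes>\<^bsub>E\<^esub> h) = k g + k h"
    "\<And>g. k (\<eta> g) = snd g"
    "\<And>n g h. g \<in> carrier E \<Longrightarrow> h \<in> carrier E \<Longrightarrow>
       2 ^ n dvd q n (g \<otimes>\<^bsub>E\<^esub> h) - q n g - parity_sign (k g) * q n h"
    "\<And>n g. 2 ^ n dvd fst g $ 2 - q n (\<eta> g)"
    "\<And>x. \<lbrakk>x \<in> carrier E; k x = 0; \<And>n. 2 ^ n dvd q n x - theta n\<rbrakk> \<Longrightarrow>
       group.commutator E (group.commutator E x (\<eta> (MC_b 1))) (\<eta> MC_t) \<noteq> \<one>\<^bsub>E\<^esub>"
proof -
  interpret E: group E using HZ by (simp add: HZ_map_iff)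
  have \<eta>: "\<eta> \<in> hom MC E" using HZ by (simp add: HZ_map_iff)
  have \<eta>c: "\<eta> g \<in> carrier E" for g using \<eta> by (auto simp: hom_def)
  obtain k :: "'e \<Rightarrow> int" and q p :: "nat \<Rightarrow> 'e \<Rightarrow> int" where
    k: "\<And>g h. g \<in> carrier E \<Longrightarrow> h \<in> carrier E \<Longrightarrow> k (g \<otimes>\<^bsub>E\<^esub> h) = k g + k h"
    and k\<eta>: "\<And>g. k (\<eta> g) = snd g"
    and q: "\<And>n g h. g \<in> carrier E \<Longrightarrow> h \<in> carrier E \<Longrightarrow>
       2 ^ n dvd q n (g \<otimes>\<^bsub>E\<^esub> h) - q n g - parity_sign (k g) * q n h"
    and q\<eta>: "\<And>n g. 2 ^ n dvd fst g $ 2 - q n (\<eta> g)"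
    and p: "\<And>n g h. g \<in> carrier E \<Longrightarrow> h \<in> carrier E \<Longrightarrow>
       2 ^ n dvd p n (g \<otimes>\<^bsub>E\<^esub> h) - p n g - parity_sign (k g) * (p n h - k g * q n h)"
    and "\<And>n g. 2 ^ n dvd fst g $ 1 - p n (\<eta> g)"
  proof (rule HZ_map_MC_crossed_homs[OF HZ], goal_cases)
    case (1 k q p)
    show ?case by (rule 1(1)[of k q p, OF 1(2-)])
  qed
  obtain \<mu> \<nu> :: "(nat \<Rightarrow> int) \<Rightarrow> rat" where
    \<mu>: "\<And>x y. \<mu> (\<lambda>i. x i + y i) = \<mu> x + \<mu> y" and \<nu>: "\<And>x y. \<nu> (\<lambda>i. x i + y i) = \<nu> x + \<nu> y"
    and \<mu>0: "\<And>x. (\<And>n. 2 ^ n dvd x n) \<Longrightarrow> \<mu> x = 0" and \<nu>0: "\<And>x. (\<And>n. 2 ^ n dvd x n) \<Longrightarrow> \<nu> x = 0"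
    and val: "\<mu> (\<lambda>i. 1) = 1" "\<mu> theta = 0" "\<nu> (\<lambda>i. 1) = 0" "\<nu> theta = 1"
  proof (rule ex_dual_functionals, goal_cases)
    case (1 \<mu> \<nu>)
    show ?case by (rule 1(1)[of \<mu> \<nu>, OF 1(2-)])
  qed
  note \<mu>_mult = additive_of_int_mult[of \<mu>, OF \<mu>] and \<nu>_mult = additive_of_int_mult[of \<nu>, OF \<nu>]
  have \<mu>_cong: "\<mu> x = \<mu> y" if "\<And>n. 2 ^ n dvd x n - y n" for x y
    using that by (intro additive_congruent[of \<mu>] \<mu> \<mu>0)
  have \<nu>_cong: "\<nu> x = \<nu> y" if "\<And>n. 2 ^ n dvd x n - y n" for x y
    using that by (intro additive_congruent[of \<nu>] \<nu> \<nu>0)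
  define a b P where "a g = \<mu> (\<lambda>n. q n g)" and "b g = \<nu> (\<lambda>n. q n g)" and "P g = \<mu> (\<lambda>n. p n g)" for g
  let ?\<sigma> = "\<lambda>g. of_int (parity_sign (k g)) :: rat"
  have a: "a (g \<otimes>\<^bsub>E\<^esub> h) = a g + ?\<sigma> g * a h"
    and b: "b (g \<otimes>\<^bsub>E\<^esub> h) = b g + ?\<sigma> g * b h"
    and P: "P (g \<otimes>\<^bsub>E\<^esub> h) = P g + ?\<sigma> g * (P h - of_int (k g) * a h)"
    if g: "g \<in> carrier E" and h: "h \<in> carrier E" for g h
  proof -
    have *: "2 ^ n dvd q n (g \<otimes>\<^bsub>E\<^esub> h) - (q n g + parity_sign (k g) * q n h)" for n
      using q[OF g h, of n] by (simp only: diff_diff_eq)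
    show "a (g \<otimes>\<^bsub>E\<^esub> h) = a g + ?\<sigma> g * a h"
      unfolding a_def using \<mu>_cong[OF *] by (simp only: \<mu> \<mu>_mult)
    show "b (g \<otimes>\<^bsub>E\<^esub> h) = b g + ?\<sigma> g * b h"
      unfolding b_def using \<nu>_cong[OF *] by (simp only: \<nu> \<nu>_mult)
    have "2 ^ n dvd p n (g \<otimes>\<^bsub>E\<^esub> h) - (p n g + parity_sign (k g) * (p n h + (- k g) * q n h))" for n
      using p[OF g h, of n] by (simp add: algebra_simps)
    from \<mu>_cong[OF this] show "P (g \<otimes>\<^bsub>E\<^esub> h) = P g + ?\<sigma> g * (P h - of_int (k g) * a h)"
      unfolding P_def a_def by (simp only: \<mu> \<mu>_mult) simp
  qed
  have q\<eta>': "2 ^ n dvd q n (\<eta> g) - (fst g $ 2) * 1" for n g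
    using q\<eta>[of n g] by (simp add: dvd_diff_commute)
  have a\<eta>: "a (\<eta> g) = of_int (fst g $ 2)" for g
    unfolding a_def \<mu>_cong[OF q\<eta>'] \<mu>_mult val by simp
  have b\<eta>: "b (\<eta> g) = 0" for g
    unfolding b_def \<nu>_cong[OF q\<eta>'] \<nu>_mult val by simp
  obtain f f' :: "'e \<Rightarrow> rat" where
    f: "\<And>g h. g \<in> carrier E \<Longrightarrow> h \<in> carrier E \<Longrightarrow> f (g \<otimes>\<^bsub>E\<^esub> h) = f g + f h + ?\<sigma> g * a g * b h"
    and f': "\<And>g h. g \<in> carrier E \<Longrightarrow> h \<in> carrier E \<Longrightarrow>
       f' (g \<otimes>\<^bsub>E\<^esub> h) = f' g + f' h + of_int (k g) * f h - ?\<sigma> g * P g * b h"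
  proof (rule HZ_map_trivializes_massey_product[of MC E \<eta> k a b P, OF HZ k a b P b\<eta>], goal_cases)
    case (9 f f')
    show ?case by (rule 9(1)[of f f', OF 9(2-)])
  qed assumption+
  have detect: "E.commutator (E.commutator x (\<eta> (MC_b 1))) (\<eta> MC_t) \<noteq> \<one>\<^bsub>E\<^esub>"
    if x: "x \<in> carrier E" and kx: "k x = 0" and qx: "\<And>n. 2 ^ n dvd q n x - theta n" for x
  proof
    \<comment> \<open>All values below are read off from \<open>W \<beta> x = x \<beta>\<close> and \<open>U T W = W T\<close>, without computing inverses.\<close>
    define \<beta> T W U where "\<beta> = \<eta> (MC_b 1)" and "T = \<eta> MC_t" and "W = E.commutator x \<beta>" and "U = E.commutator W T"
    have c [simp]: "x \<in> carrier E" "\<beta> \<in> carrier E" "T \<in> carrier E"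
      using x \<eta>c by (simp_all add: \<beta>_def T_def)
    then have cW [simp]: "W \<in> carrier E" by (simp add: W_def)
    then have cU [simp]: "U \<in> carrier E" by (simp add: U_def)
    have W: "W \<otimes>\<^bsub>E\<^esub> (\<beta> \<otimes>\<^bsub>E\<^esub> x) = x \<otimes>\<^bsub>E\<^esub> \<beta>" and U: "U \<otimes>\<^bsub>E\<^esub> (T \<otimes>\<^bsub>E\<^esub> W) = W \<otimes>\<^bsub>E\<^esub> T"
      unfolding W_def U_def by (rule E.commutator_swap; simp flip: W_def)+
    have vals: "k \<beta> = 0" "k T = 1" "a \<beta> = 1" "b \<beta> = 0" "b T = 0"
      by (simp_all add: \<beta>_def T_def k\<eta> a\<eta> b\<eta>)
    have ax: "a x = 0" and bx: "b x = 1"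
      using \<mu>_cong[OF qx] \<nu>_cong[OF qx] by (simp_all add: a_def b_def val)
    have kW: "k W = 0" and kU: "k U = 0"
      using arg_cong[OF W, of k] arg_cong[OF U, of k] by (simp_all add: k)
    have aW: "a W = 0" and bW: "b W = 0"
      using arg_cong[OF W, of a] arg_cong[OF W, of b] by (simp_all add: a b kW kx vals)
    have fW: "f W = -1"
      using arg_cong[OF W, of f] by (simp add: f kW kx vals ax bx aW)
    have "f' U = 1"
      using arg_cong[OF U, of f'] by (simp add: f' b kW kU vals bW fW)
    moreover assume "E.commutator (E.commutator x (\<eta> (MC_b 1))) (\<eta> MC_t) = \<one>\<^bsub>E\<^esub>"
    then have "U = \<one>\<^bsub>E\<^esub>" by (simp add: U_def W_def \<beta>_def T_def)
    moreover have "b \<one>\<^bsub>E\<^esub> = 0" "k \<one>\<^bsub>E\<^esub> = 0"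
      using b[of "\<one>\<^bsub>E\<^esub>" "\<one>\<^bsub>E\<^esub>"] k[of "\<one>\<^bsub>E\<^esub>" "\<one>\<^bsub>E\<^esub>"] by simp_all
    then have "f' \<one>\<^bsub>E\<^esub> = 0"
      using f'[of "\<one>\<^bsub>E\<^esub>" "\<one>\<^bsub>E\<^esub>"] by simp
    ultimately show False by simp
  qed
  show thesis by (rule that[of k q, OF k k\<eta> q q\<eta> detect])
qed

section \<open>The commutator detected at stage \<open>\<omega> + 1\<close>\<close>

text \<open>
  By induction on \<open>m\<close>, each \<open>x\<^sub>j\<close> is a product \<open>h z\<close> with \<open>h \<in> H\<close> and \<open>z\<close> in the \<open>m\<close>-th term: if
  \<open>x\<^bsub>j+1\<^esub> = h z\<close>, then \<open>[h z, t]\<close> is a conjugate of \<open>[z, t]\<close> times \<open>[h, t] \<in> H\<close>. As \<open>b\<close>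
  commutes with \<open>h\<close>, only the conjugate of \<open>[z, b]\<close> remains of \<open>[h z, b]\<close>.
\<close>

lemma (in group) tower_commutator_in_lcs:
  assumes H: "subgroup H G" and u: "\<And>n. u n \<in> H" and x: "\<And>n. x n \<in> carrier G"
    and t: "t \<in> carrier G" "\<And>h. h \<in> H \<Longrightarrow> commutator h t \<in> H"
    and tower: "\<And>n. x n = u n \<otimes> commutator (x (Suc n)) t"
    and b: "b \<in> carrier G" "\<And>h. h \<in> H \<Longrightarrow> commutator h b = \<one>"
  shows "commutator (x j) b \<in> lcs m"
proof -
  interpret H: subgroup H G by (rule H)
  have lcs: "z \<in> carrier G" if "z \<in> lcs m" for z m
    using that normal_imp_subgroup[OF lcs_normal] subgroup.subset by blast
  have conj: "g \<otimes> z \<otimes> inv g \<in> lcs m" if "g \<in> carrier G" "z \<in> lcs m" for g z m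
    using normal.inv_op_closed2[OF lcs_normal that] .
  have approx: "\<exists>h\<in>H. \<exists>z\<in>lcs m. x j = h \<otimes> z" for m j
  proof (induction m arbitrary: j)
    case 0
    show ?case using x[of j] H.one_closed by (intro bexI[of _ \<one>] bexI[of _ "x j"]) simp_all
  next
    case (Suc m)
    obtain h z where h: "h \<in> H" and z: "z \<in> lcs m" and xj: "x (Suc j) = h \<otimes> z"
      using Suc by blast
    have zc: "z \<in> carrier G" and hc: "h \<in> carrier G" using lcs[OF z] h H.mem_carrier by auto
    let ?w = "commutator h t" and ?y = "h \<otimes> commutator z t \<otimes> inv h"
    have y: "?y \<in> lcs (Suc m)" by (intro conj commutator_in_lcs z t hc)
    have yc: "?y \<in> carrier G" by (rule lcs[OF y])
    have w: "?w \<in> H" by (rule t(2)[OF h])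
    have wc: "?w \<in> carrier G" by (rule H.mem_carrier[OF w])
    have "x j = u j \<otimes> (?y \<otimes> ?w)"
      using tower[of j] commutator_mult_left[OF hc zc t(1)] by (simp only: xj)
    also have "?y \<otimes> ?w = ?w \<otimes> (inv ?w \<otimes> ?y \<otimes> inv (inv ?w))"
      using yc wc by (simp add: m_assoc[symmetric] del: inv_mult_group)
    finally have "x j = (u j \<otimes> ?w) \<otimes> (inv ?w \<otimes> ?y \<otimes> inv (inv ?w))"
      using yc wc H.mem_carrier[OF u] by (simp only: m_assoc m_closed inv_closed)
    moreover have "inv ?w \<otimes> ?y \<otimes> inv (inv ?w) \<in> lcs (Suc m)"
      by (intro conj y inv_closed wc)
    ultimately show ?case using H.m_closed[OF u w] by blast
  qed
  show ?thesis
  proof (cases m)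
    case 0
    then show ?thesis using x b by simp
  next
    case (Suc k)
    obtain h z where h: "h \<in> H" and z: "z \<in> lcs k" and xj: "x j = h \<otimes> z"
      using approx by blast
    have zc: "z \<in> carrier G" and hc: "h \<in> carrier G" using lcs[OF z] h H.mem_carrier by auto
    have "commutator (x j) b = h \<otimes> commutator z b \<otimes> inv h"
      unfolding xj commutator_mult_left[OF hc zc b(1)] b(2)[OF h] using hc zc b(1) by simp
    then show ?thesis using conj[OF hc commutator_in_lcs[OF z b(1)]] Suc by simp
  qed
qed

text \<open>
  Since \<open>q [y, t] = 2 q y\<close> when \<open>k y = 0\<close> and \<open>k t = 1\<close>, the system gives \<open>q x\<^sub>j = c\<^sub>j + 2 q x\<^bsub>j+1\<^esub>\<close>, which
  is iterated \<open>n\<close> times.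
\<close>

lemma tower_two_adic_value:
  assumes "group E"
    and k: "\<And>g h. g \<in> carrier E \<Longrightarrow> h \<in> carrier E \<Longrightarrow> k (g \<otimes>\<^bsub>E\<^esub> h) = k g + k h"
    and q: "\<And>n g h. g \<in> carrier E \<Longrightarrow> h \<in> carrier E \<Longrightarrow>
       2 ^ n dvd q n (g \<otimes>\<^bsub>E\<^esub> h) - q n g - parity_sign (k g) * q n h"
    and t: "t \<in> carrier E" "k t = 1"
    and u: "\<And>j. u j \<in> carrier E" "\<And>j. k (u j) = 0" "\<And>n j. 2 ^ n dvd c j - q n (u j)"
    and x: "\<And>j. x j \<in> carrier E" "\<And>j. x j = u j \<otimes>\<^bsub>E\<^esub> group.commutator E (x (Suc j)) t"
  shows "k (x j) = 0" "2 ^ n dvd q n (x 0) - (\<Sum>i<n. 2 ^ i * c i)"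
proof -
  interpret group E by fact
  define C where "C j = commutator (x (Suc j)) t" for j
  have C: "C j \<in> carrier E" for j using x(1) t by (simp add: C_def)
  have Ct: "C j \<otimes>\<^bsub>E\<^esub> (t \<otimes>\<^bsub>E\<^esub> x (Suc j)) = x (Suc j) \<otimes>\<^bsub>E\<^esub> t" for j
    unfolding C_def by (rule commutator_swap[OF x(1) t(1)])
  have xj: "x j = u j \<otimes>\<^bsub>E\<^esub> C j" for j unfolding C_def by (rule x(2))
  have kC: "k (C j) = 0" for j
    using arg_cong[OF Ct[of j], of k] x(1) t C by (simp add: k)
  show kx: "k (x j) = 0" for j
    using arg_cong[OF xj[of j], of k] u C by (simp add: k kC)
  have qC: "2 ^ n dvd q n (C j) - 2 * q n (x (Suc j))" for n j
  proof -
    let ?y = "x (Suc j)"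
    have 1: "2 ^ n dvd q n (?y \<otimes>\<^bsub>E\<^esub> t) - q n ?y - q n t"
      using q[OF x(1)[of "Suc j"] t(1), of n] by (simp add: kx)
    have 2: "2 ^ n dvd q n (?y \<otimes>\<^bsub>E\<^esub> t) - q n (C j) - q n (t \<otimes>\<^bsub>E\<^esub> ?y)"
      using q[OF C[of j] m_closed[OF t(1) x(1)[of "Suc j"]], of n] by (simp add: kC Ct)
    have 3: "2 ^ n dvd q n (t \<otimes>\<^bsub>E\<^esub> ?y) - q n t + q n ?y"
      using q[OF t(1) x(1)[of "Suc j"], of n] by (simp add: t(2))
    show ?thesis using dvd_diff[OF dvd_diff[OF 1 2] 3] by (simp add: algebra_simps)
  qed
  have step: "2 ^ n dvd q n (x j) - (c j + 2 * q n (x (Suc j)))" for n j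
  proof -
    have "2 ^ n dvd q n (x j) - q n (u j) - q n (C j)"
      using q[OF u(1)[of j] C[of j], of n] by (simp add: u(2) xj[symmetric])
    from dvd_add[OF dvd_diff[OF this u(3)[of n j]] qC[of n j]]
    show ?thesis by (simp add: algebra_simps)
  qed
  have "2 ^ n dvd q n (x 0) - ((\<Sum>i<j. 2 ^ i * c i) + 2 ^ j * q n (x j))" for j
  proof (induction j)
    case (Suc j)
    from dvd_add[OF Suc dvd_mult[OF step[of n j], of "2 ^ j"]]
    show ?case by (simp add: algebra_simps)
  qed simp
  from dvd_add[OF this[of n] dvd_triv_left[of "2 ^ n" "q n (x n)"]]
  show "2 ^ n dvd q n (x 0) - (\<Sum>i<n. 2 ^ i * c i)" by simp
qed

theorem theorem5p5:
  fixes \<tau> :: "'o rel"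
  assumes "is_HZ_length TYPE('e) MC \<tau>"
  shows "omega_plus_one <o \<tau>"
proof (rule ccontr)
  assume not_less: "\<not> omega_plus_one <o \<tau>"
  obtain E :: "'e monoid" and \<eta> where
    HZ: "HZ_map MC E \<eta>" and loc: "HZ_local TYPE('e set) E" and len: "is_lower_central_length E \<tau>"
    using assms by (auto simp: is_HZ_length_def HZ_localization_def)
  have W\<tau>: "Well_order \<tau>" and trivial: "lower_central E \<tau> = {\<one>\<^bsub>E\<^esub>}"
    using len by (simp_all add: is_lower_central_length_def)
  have \<tau>: "\<tau> \<le>o omega_plus_one"
    using not_less not_ordLess_iff_ordLeq[OF W\<tau> Well_order_omega_plus_one] by blast
  interpret E: group E using HZ by (simp add: HZ_map_iff)
  interpret \<eta>: group_hom MC E \<eta>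
    using HZ by (simp add: HZ_map_iff group_hom_def group_hom_axioms_def)
  have \<eta>c [simp]: "\<eta> g \<in> carrier E" for g by (rule \<eta>.hom_closed) simp
  obtain k :: "'e \<Rightarrow> int" and q :: "nat \<Rightarrow> 'e \<Rightarrow> int" where
    k: "\<And>g h. g \<in> carrier E \<Longrightarrow> h \<in> carrier E \<Longrightarrow> k (g \<otimes>\<^bsub>E\<^esub> h) = k g + k h"
    and k\<eta>: "\<And>g. k (\<eta> g) = snd g"
    and q: "\<And>n g h. g \<in> carrier E \<Longrightarrow> h \<in> carrier E \<Longrightarrow>
       2 ^ n dvd q n (g \<otimes>\<^bsub>E\<^esub> h) - q n g - parity_sign (k g) * q n h"
    and q\<eta>: "\<And>n g. 2 ^ n dvd fst g $ 2 - q n (\<eta> g)"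
    and detect: "\<And>x. \<lbrakk>x \<in> carrier E; k x = 0; \<And>n. 2 ^ n dvd q n x - theta n\<rbrakk> \<Longrightarrow>
       E.commutator (E.commutator x (\<eta> (MC_b 1))) (\<eta> MC_t) \<noteq> \<one>\<^bsub>E\<^esub>"
  proof (rule HZ_map_MC_commutator_detection[OF HZ], goal_cases)
    case (1 k q)
    show ?case by (rule 1(1)[of k q, OF 1(2-)])
  qed
  \<comment> \<open>The type carrying \<open>E\<close> is infinite, so locality applies to maps of countable free groups.\<close>
  have "inj (\<lambda>i :: int. \<eta> (0, i))"
    by (rule inj_on_inverseI[of _ k]) (simp add: k\<eta>)
  then have "infinite (UNIV :: 'e set)"
    using infinite_UNIV_int finite_subset[OF subset_UNIV] finite_imageD by metis
  then obtain w :: "nat \<Rightarrow> 'e" where w: "inj w"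
    using infinite_countable_subset by blast
  have inj: "inj (\<lambda>v :: letter list. {w (to_nat v)})"
    by (rule injI) (simp add: inj_eq[OF w])
  \<comment> \<open>an expansion \<open>\<theta> = \<Sum> c\<^sub>j 2\<^sup>j\<close> with integer coefficients, whose partial sums telescope to \<open>theta\<close>\<close>
  define c where "c j = (theta (Suc j) - theta j) div 2 ^ j" for j
  obtain x where x: "\<And>j. x j \<in> carrier E"
    "\<And>j. x j = \<eta> (MC_b (c j)) \<otimes>\<^bsub>E\<^esub> E.commutator (x (Suc j)) (\<eta> MC_t)"
  proof (rule HZ_local_solve_tower[OF loc inj, of "\<lambda>j. \<eta> (MC_b (c j))" "\<eta> MC_t", OF \<eta>c \<eta>c], goal_cases)
    case (1 x)
    show ?case by (rule 1(1)[of x, OF 1(2-)])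
  qed
  have c: "2 ^ j * c j = theta (Suc j) - theta j" for j
    unfolding c_def using theta_Suc_diff[of j] by (rule dvd_mult_div_cancel)
  have theta: "(\<Sum>i<n. 2 ^ i * c i) = theta n" for n
    by (induction n) (simp_all add: c del: theta.simps(2))
  have kt: "k (\<eta> MC_t) = 1" and ku: "k (\<eta> (MC_b (c j))) = 0"
    and qu: "2 ^ n dvd c j - q n (\<eta> (MC_b (c j)))" for n j
    using q\<eta>[of n "MC_b (c j)"] by (simp_all add: k\<eta>)
  have kx: "k (x 0) = 0"
    by (rule tower_two_adic_value(1)[of E k q "\<eta> MC_t" "\<lambda>j. \<eta> (MC_b (c j))" c x,
          OF E.is_group k q \<eta>c kt \<eta>c ku qu x])
  have "2 ^ n dvd q n (x 0) - (\<Sum>i<n. 2 ^ i * c i)" for n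
    by (rule tower_two_adic_value(2)[of E k q "\<eta> MC_t" "\<lambda>j. \<eta> (MC_b (c j))" c x,
          OF E.is_group k q \<eta>c kt \<eta>c ku qu x])
  then have qx: "2 ^ n dvd q n (x 0) - theta n" for n
    by (simp only: theta)
  let ?H = "\<eta> ` {g. snd g = 0}"
  have "subgroup {g. snd g = 0} MC"
  proof (rule \<eta>.G.subgroupI)
    fix g assume "g \<in> {g :: (int ^ 2) \<times> int. snd g = 0}"
    then show "inv\<^bsub>MC\<^esub> g \<in> {g. snd g = 0}"
      using mult_MC(3)[of g "inv\<^bsub>MC\<^esub> g"] mult_MC(3)[of "\<one>\<^bsub>MC\<^esub>" "\<one>\<^bsub>MC\<^esub>"] by simp
  qed (auto simp: mult_MC intro: exI[of _ 0])
  then have H: "subgroup ?H E"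
    by (rule \<eta>.subgroup_img_is_subgroup)
  have MC_inv: "snd (inv\<^bsub>MC\<^esub> g) = - snd g" for g
    using mult_MC(3)[of g "inv\<^bsub>MC\<^esub> g"] mult_MC(3)[of "\<one>\<^bsub>MC\<^esub>" "\<one>\<^bsub>MC\<^esub>"] by simp
  have commutator_t: "E.commutator h (\<eta> MC_t) \<in> ?H" if h: "h \<in> ?H" for h
  proof -
    obtain g where g: "h = \<eta> g" "snd g = 0" using h by blast
    have "E.commutator h (\<eta> MC_t) = \<eta> (\<eta>.G.commutator g MC_t)" by (simp add: g)
    moreover have "snd (\<eta>.G.commutator g MC_t) = 0" by (simp add: mult_MC MC_inv g)
    ultimately show ?thesis by blast
  qed
  have commutator_b: "E.commutator h (\<eta> (MC_b 1)) = \<one>\<^bsub>E\<^esub>" if h: "h \<in> ?H" for h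
  proof -
    obtain g where g: "h = \<eta> g" "snd g = 0" using h by blast
    have "g \<otimes>\<^bsub>MC\<^esub> MC_b 1 = MC_b 1 \<otimes>\<^bsub>MC\<^esub> g"
      by (rule MC_eqI) (simp_all add: mult_MC g)
    then have "\<eta> g \<otimes>\<^bsub>E\<^esub> \<eta> (MC_b 1) = \<eta> (MC_b 1) \<otimes>\<^bsub>E\<^esub> \<eta> g"
      by (simp flip: \<eta>.hom_mult)
    then show ?thesis by (simp add: g E.m_assoc)
  qed
  have uH: "\<eta> (MC_b (c j)) \<in> ?H" for j by simp
  have "E.commutator (x 0) (\<eta> (MC_b 1)) \<in> E.lcs m" for m
    by (rule E.tower_commutator_in_lcs[of ?H "\<lambda>j. \<eta> (MC_b (c j))" x "\<eta> MC_t" "\<eta> (MC_b 1)",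
          OF H uH x(1) \<eta>c commutator_t x(2) \<eta>c commutator_b])
  then have "E.commutator (E.commutator (x 0) (\<eta> (MC_b 1))) (\<eta> MC_t) \<in> lower_central E \<tau>"
    by (intro E.lower_central_omega_plus_one \<tau>) simp_all
  then show False
    using detect[OF x(1) kx qx] trivial by simp
qed

end
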